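(* Let $p\ge2$, $s>0$, $0\le\mu\le L$, $r>0$, and let $N\ge1$ and $d$ be integers with $N\le\frac{d-1}{2}$. For any first-order method running for $N$ iterations from $x_0=0$, there is a regularized quadratic function $$f(x)=\tfrac12x^\top Ax-b^\top x+\tfrac sp\|x\|^p,\qquad x\in\mathbb{R}^d,$$ with $A\in\mathbb{R}^{d\times d}$ symmetric positive semidefinite and $b\in\mathbb{R}^d$, such that its minimizer $x_\star$ satisfies $\|x_\star\|=r$, $\lambda_{\min}(A)=\mu$, $\lambda_{\max}(A)=L$, and, with $$Q_\star:=\frac{L+sr^{p-2}}{\mu+sr^{p-2}}\ge1,$$ the output $x_N$ of the method applied to $f$ satisfies $$\|x_N-x_\star\|\ \ge\ r\exp\Bigl(-\frac{8N}{\sqrt{Q_\star}-1}\Bigr),$$ $$f(x_N)-f_\star\ \ge\ \frac{s}{p2^{p-2}}\,r^p\exp\Bigl(-\frac{8pN}{\sqrt{Q_\star}-1}\Bigr),$$ $$\|\nabla f(x_N)\|\ \ge\ \frac{2^{2-p}s}{(p-1)^{(p-1)/p}}\,r^{p-1}\exp\Bigl(-\frac{8(p-1)N}{\sqrt{Q_\star}-1}\Bigr),$$ where $f_\star=f(x_\star)$.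
   Context: A first-order method is a sequence of (deterministic) mappings $\mathcal M=(\mathcal M_0,\mathcal M_1,\ldots)$; applied to $f$ from $x_0=0$ it generates $x_{k+1}=\mathcal M_k(\mathcal I_f(x_0),\ldots,\mathcal I_f(x_k))$, where $\mathcal I_f(x)=\{f(x),\nabla f(x)\}$ is the first-order oracle. The result of the method after $N$ iterations is $x_N$. $\|\cdot\|$ is the Euclidean norm. When $\mu=L$ (so $Q_\star=1$) the exponentials are interpreted as $0$. *)

theory Defs
  imports "HOL-Analysis.Analysis"
begin

definition gradient :: "('a::real_inner \<Rightarrow> real) \<Rightarrow> 'a \<Rightarrow> 'a" where
  "gradient f x = (THE g. GDERIV f x :> g)"

definition fo_info :: "('a::real_inner \<Rightarrow> real) \<Rightarrow> 'a \<Rightarrow> real \<times> 'a" where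
  "fo_info f x = (f x, gradient f x)"

(* Only the values of M k on lists of length k + 1 matter: the list holds the
   pairs fo_info f x_i for i = 0, ..., k in this order. *)
type_synonym 'a first_order_method = "nat \<Rightarrow> (real \<times> 'a) list \<Rightarrow> 'a"

fun iterate :: "'a::real_inner first_order_method \<Rightarrow> ('a \<Rightarrow> real) \<Rightarrow> nat \<Rightarrow> 'a" where
  "iterate M f 0 = 0"
| "iterate M f (Suc k) = M k (map (\<lambda>i. fo_info f (iterate M f i)) [0..<Suc k])"

definition symmetric_mat :: "real ^ 'n ^ 'n \<Rightarrow> bool" where
  "symmetric_mat A \<longleftrightarrow> transpose A = A"

definition psd_mat :: "real ^ 'n ^ 'n \<Rightarrow> bool" where
  "psd_mat A \<longleftrightarrow> symmetric_mat A \<and> (\<forall>x. 0 \<le> x \<bullet> (A *v x))"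

definition eigenvalues :: "real ^ 'n ^ 'n \<Rightarrow> real set" where
  "eigenvalues A = {c. \<exists>v. v \<noteq> 0 \<and> A *v v = c *\<^sub>R v}"

(* Meant for symmetric A, whose set of real eigenvalues is finite and nonempty. *)
definition lambda_min :: "real ^ 'n ^ 'n \<Rightarrow> real" where
  "lambda_min A = Min (eigenvalues A)"

definition lambda_max :: "real ^ 'n ^ 'n \<Rightarrow> real" where
  "lambda_max A = Max (eigenvalues A)"

definition reg_quadratic ::
    "real \<Rightarrow> real \<Rightarrow> real ^ 'n ^ 'n \<Rightarrow> real ^ 'n \<Rightarrow> real ^ 'n \<Rightarrow> real" where
  "reg_quadratic p s A b x =
     1 / 2 * (x \<bullet> (A *v x)) - b \<bullet> x + s / p * norm x powr p"

(* exp (- c / (sqrt Q - 1)), read as 0 in the degenerate case Q = 1, where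
   division by zero would otherwise give exp 0 = 1. *)
definition exp_rate :: "real \<Rightarrow> real \<Rightarrow> real" where
  "exp_rate c Q = (if Q = 1 then 0 else exp (- (c / (sqrt Q - 1))))"

end

theory Submission
  imports Defs
begin

text \<open>Writing \<open>\<sigma> = s r\<^sup>p\<^sup>-\<^sup>2\<close>, a point \<open>z\<close> of norm \<open>r\<close> is stationary iff \<open>(A + \<sigma> I) z = b\<close>, so the problem
  reduces to a strongly convex quadratic of condition number \<open>Q\<close>. With \<open>m = 2 N\<close>, let \<open>A + \<sigma> I\<close> be tridiagonal
  in an orthonormal family \<open>u\<^sub>0, \<dots>, u\<^sub>m\<close> and \<open>b\<close> a multiple of \<open>u\<^sub>0\<close>. A resisting oracle fixes the family on
  the fly, two vectors per query, so that \<open>x\<^sub>N\<close> lies in the span of \<open>u\<^sub>0, \<dots>, u\<^sub>m\<^sub>-\<^sub>1\<close> and its distance to \<open>z\<close>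
  is at least the last coordinate of \<open>z\<close>. The best constant comes from the Chebyshev polynomial \<open>T\<^sub>m\<close>: the
  spectrum is placed at its extremal points, and the spectral weights of \<open>z\<close> are the Gauss-Lobatto weights
  divided by the eigenvalues. The Cholesky factors of this matrix are quotients of hyperbolic
  functions of \<open>\<theta>\<close>, where \<open>e\<^sup>\<theta> = (\<surd>Q + 1) / (\<surd>Q - 1)\<close>, and the last coordinate of \<open>z\<close> is \<open>r / cosh (m \<theta>)\<close>.
  Uniform convexity of \<open>\<parallel>x\<parallel>\<^sup>p\<close> turns the distance bound into the other two.\<close>

section \<open>Uniform convexity of powers of the norm\<close>

lemma powr_convex_combination_le:
  fixes a b l t :: real
  assumes "0 \<le> a" "0 \<le> b" "0 \<le> l" "l \<le> 1" "1 \<le> t"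
  shows "((1 - l) * a + l * b) powr t \<le> (1 - l) * a powr t + l * b powr t"
proof -
  \<comment> \<open>Settles the cases where one of the two points is 0; for two positive points the
    claim is plain convexity of the power.\<close>
  have scale: "(k * c) powr t \<le> k * c powr t" if "0 \<le> k" "k \<le> 1" "0 \<le> c" for k c :: real
  proof -
    have "k powr t \<le> k"
      using that assms(5) powr_mono'[of 1 t k] by (cases "k = 0") auto
    then show ?thesis
      using that by (simp add: powr_mult mult_right_mono)
  qed
  consider "a = 0" | "b = 0" | "0 < a" "0 < b"
    using assms by linarith
  then show ?thesis
  proof cases
    case 3
    then show ?thesis
      using convex_onD[OF powr_convex[OF assms(5)], of l a b] assms by simp
  qed (use scale[of l b] scale[of "1 - l" a] assms in auto)
qed

text \<open>Peeling off one factor, c^t = c * c^(t-1), both (a-b)^(t-1) and b^(t-1) are at most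
  a^(t-1), and the linear factors a-b and b add up to a.\<close>

lemma powr_diff_le:
  fixes a b t :: real
  assumes "0 \<le> b" "b \<le> a" "1 \<le> t"
  shows "(a - b) powr t \<le> a powr t - b powr t"
proof -
  have split: "c powr t = c * c powr (t - 1)" if "0 \<le> c" for c :: real
    using powr_mult_base[OF that, of "t - 1"] by simp
  have "(a - b) * (a - b) powr (t - 1) \<le> (a - b) * a powr (t - 1)"
    "b * b powr (t - 1) \<le> b * a powr (t - 1)"
    using assms by (auto intro!: mult_left_mono powr_mono2)
  then show ?thesis
    using assms by (simp add: split algebra_simps)
qed

text \<open>For fixed norms of \<open>x\<close> and \<open>y\<close> the left-hand side is affine in \<open>(norm (x - y))\<^sup>2\<close> and the
  right-hand side convex, so only the two collinear configurations need checking.\<close>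

lemma norm_powr_uniformly_monotone:
  fixes x y :: "'a::real_inner"
  assumes "2 \<le> p"
  shows "(norm x powr (p - 2) *\<^sub>R x - norm y powr (p - 2) *\<^sub>R y) \<bullet> (x - y)
    \<ge> 2 powr (2 - p) * norm (x - y) powr p"
proof -
  define \<alpha> where "\<alpha> = max (norm x) (norm y)"
  define \<beta> where "\<beta> = min (norm x) (norm y)"
  define q where "q = p - 2"
  define u where "u = (norm (x - y))\<^sup>2"
  define A where "A = (\<alpha> powr q + \<beta> powr q) / 2"
  define B where "B = (\<alpha> powr q - \<beta> powr q) * (\<alpha>\<^sup>2 - \<beta>\<^sup>2) / 2"
  define h where "h v = 2 powr (2 - p) * v powr (p / 2)" for v :: real
  have \<alpha>\<beta>: "0 \<le> \<beta>" "\<beta> \<le> \<alpha>"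
    by (auto simp: \<alpha>_def \<beta>_def)
  have xy: "x \<bullet> y = ((norm x)\<^sup>2 + (norm y)\<^sup>2 - u) / 2"
    by (simp add: u_def power2_norm_eq_inner algebra_simps inner_commute)
  have "(norm x powr q *\<^sub>R x - norm y powr q *\<^sub>R y) \<bullet> (x - y)
      = norm x powr q * (norm x)\<^sup>2 + norm y powr q * (norm y)\<^sup>2
        - (norm x powr q + norm y powr q) * (x \<bullet> y)"
    by (simp add: power2_norm_eq_inner algebra_simps inner_commute)
  also have "\<dots> = A * u + B"
    unfolding xy A_def B_def \<alpha>_def \<beta>_def max_def min_def by (auto simp: field_simps)
  finally have lhs: "(norm x powr q *\<^sub>R x - norm y powr q *\<^sub>R y) \<bullet> (x - y) = A * u + B" .
  have sq: "(w\<^sup>2) powr (p / 2) = w powr p" if "0 \<le> w" for w :: real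
    using that by (simp add: powr_powr flip: powr_numeral)
  have split: "c powr (p - 1) = c * c powr q" if "0 \<le> c" for c :: real
    using powr_mult_base[OF that, of q] by (simp add: q_def)
  \<comment> \<open>Opposite directions: a factor \<alpha> + \<beta> splits off and midpoint
    convexity of the power p - 1 remains. This is where the constant 2^(2-p) comes from.\<close>
  have hi: "h ((\<alpha> + \<beta>)\<^sup>2) \<le> A * (\<alpha> + \<beta>)\<^sup>2 + B"
  proof -
    have "(\<alpha> + \<beta>) powr p = (\<alpha> + \<beta>) * (\<alpha> + \<beta>) powr (p - 1)"
      using powr_mult_base[of "\<alpha> + \<beta>" "p - 1"] \<alpha>\<beta> by simp
    moreover have "2 powr (2 - p) * (\<alpha> + \<beta>) powr (p - 1) \<le> \<alpha> powr (p - 1) + \<beta> powr (p - 1)"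
    proof -
      have "2 powr (2 - p) = 2 / 2 powr (p - 1)"
        using powr_diff[of 2 1 "p - 1"] by (simp add: algebra_simps)
      then have "2 powr (2 - p) * (\<alpha> + \<beta>) powr (p - 1) = 2 * ((\<alpha> + \<beta>) / 2) powr (p - 1)"
        using \<alpha>\<beta> by (simp add: powr_divide)
      also have "(\<alpha> + \<beta>) / 2 = (1 - 1/2) * \<alpha> + 1/2 * \<beta>"
        by simp
      finally show ?thesis
        using powr_convex_combination_le[of \<alpha> \<beta> "1/2" "p - 1"] \<alpha>\<beta> assms by simp
    qed
    ultimately have "h ((\<alpha> + \<beta>)\<^sup>2) \<le> (\<alpha> + \<beta>) * (\<alpha> powr (p - 1) + \<beta> powr (p - 1))"
      using mult_left_mono[of _ _ "\<alpha> + \<beta>"] \<alpha>\<beta> by (simp add: h_def sq mult.left_commute)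
    also have "\<dots> = A * (\<alpha> + \<beta>)\<^sup>2 + B"
      using \<alpha>\<beta> by (simp add: split A_def B_def field_simps power2_eq_square)
    finally show ?thesis .
  qed
  \<comment> \<open>Equal directions: the constant is at most 1 and superadditivity of the power p -
    1 suffices.\<close>
  have lo: "h ((\<alpha> - \<beta>)\<^sup>2) \<le> A * (\<alpha> - \<beta>)\<^sup>2 + B"
  proof -
    have "2 powr (2 - p) \<le> (1::real)"
      using powr_mono[of "2 - p" 0 2] assms by simp
    then have "h ((\<alpha> - \<beta>)\<^sup>2) \<le> (\<alpha> - \<beta>) powr p"
      using \<alpha>\<beta> by (simp add: h_def sq mult_left_le_one_le)
    also have "\<dots> = (\<alpha> - \<beta>) * (\<alpha> - \<beta>) powr (p - 1)"
      using powr_mult_base[of "\<alpha> - \<beta>" "p - 1"] \<alpha>\<beta> by simp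
    also have "\<dots> \<le> (\<alpha> - \<beta>) * (\<alpha> powr (p - 1) - \<beta> powr (p - 1))"
      using powr_diff_le[of \<beta> \<alpha> "p - 1"] \<alpha>\<beta> assms by (intro mult_left_mono) auto
    also have "\<dots> = A * (\<alpha> - \<beta>)\<^sup>2 + B"
      using \<alpha>\<beta> by (simp add: split A_def B_def field_simps power2_eq_square)
    finally show ?thesis .
  qed
  have "\<alpha> - \<beta> \<le> norm (x - y)"
    using norm_triangle_ineq3[of x y] by (auto simp: \<alpha>_def \<beta>_def)
  moreover have "norm (x - y) \<le> \<alpha> + \<beta>"
    using norm_triangle_ineq4[of x y] by (auto simp: \<alpha>_def \<beta>_def)
  ultimately have "(\<alpha> - \<beta>)\<^sup>2 \<le> u" "u \<le> (\<alpha> + \<beta>)\<^sup>2"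
    unfolding u_def using \<alpha>\<beta> by (intro power_mono; linarith)+
  then have "u \<in> closed_segment ((\<alpha> - \<beta>)\<^sup>2) ((\<alpha> + \<beta>)\<^sup>2)"
    by (subst closed_segment_eq_real_ivl1) auto
  then obtain l where l: "u = (1 - l) * (\<alpha> - \<beta>)\<^sup>2 + l * (\<alpha> + \<beta>)\<^sup>2" "0 \<le> l" "l \<le> 1"
    unfolding in_segment real_scaleR_def by blast
  have "h u \<le> (1 - l) * h ((\<alpha> - \<beta>)\<^sup>2) + l * h ((\<alpha> + \<beta>)\<^sup>2)"
    using mult_left_mono[OF powr_convex_combination_le[of "(\<alpha> - \<beta>)\<^sup>2" "(\<alpha> + \<beta>)\<^sup>2" l "p / 2"],
        of "2 powr (2 - p)"] l(2,3) assms
    unfolding h_def l(1) by (simp add: distrib_left mult.left_commute)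
  also have "\<dots> \<le> (1 - l) * (A * (\<alpha> - \<beta>)\<^sup>2 + B) + l * (A * (\<alpha> + \<beta>)\<^sup>2 + B)"
    using l(2,3) lo hi by (intro add_mono mult_left_mono) simp_all
  also have "\<dots> = A * u + B"
    unfolding l(1) by (simp add: algebra_simps)
  finally show ?thesis
    using lhs by (simp add: h_def u_def sq q_def)
qed

section \<open>Gradient and growth of the regularized quadratic\<close>

lemma GDERIV_norm_powr:
  fixes x :: "'a::real_inner"
  assumes "2 \<le> p"
  shows "GDERIV (\<lambda>x. norm x powr p) x :> (p * norm x powr (p - 2)) *\<^sub>R x"
proof (cases "x = 0")
  case True
  have "((\<lambda>h::'a. norm h powr p) has_derivative (\<lambda>h. 0)) (at 0)"
  proof (rule has_derivativeI_sandwich[where e = 1 and H = norm])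
    fix h :: 'a assume h: "h \<noteq> 0" "dist h 0 < 1"
    \<comment> \<open>The norm itself is not differentiable at 0; on the unit ball p \<ge> 2 bounds
      the difference quotient by \<open>norm h\<close>.\<close>
    have "norm h powr p \<le> norm h powr 2"
      using h assms by (intro powr_mono') auto
    then show "norm (norm h powr p - norm (0::'a) powr p - 0) / norm (h - 0) \<le> norm h"
      using h by (simp add: divide_le_eq power2_eq_square)
  qed (auto intro!: tendsto_eq_intros)
  then show ?thesis
    using True by (simp add: gderiv_def)
next
  case False
  have "GDERIV (\<lambda>x. norm x powr p) x :> (p * norm x powr (p - 1)) *\<^sub>R sgn x"
    using False by (intro GDERIV_DERIV_compose GDERIV_norm has_real_derivative_powr) auto
  moreover have "norm x powr (p - 1) = norm x * norm x powr (p - 2)"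
    using powr_mult_base[of "norm x" "p - 2"] by simp
  ultimately show ?thesis
    using False by (simp add: sgn_div_norm field_simps)
qed

lemma gradient_eqI: "GDERIV f x :> g \<Longrightarrow> gradient f x = g"
  unfolding gradient_def
proof (rule the_equality)
  fix g' assume "GDERIV f x :> g" "GDERIV f x :> g'"
  then have "(\<lambda>h. h \<bullet> g') = (\<lambda>h. h \<bullet> g)"
    unfolding gderiv_def by (rule has_derivative_unique[rotated])
  then show "g' = g"
    by (metis inner_commute vector_eq_rdot)
qed

lemma symmetric_mat_inner:
  fixes A :: "real^'n^'n"
  assumes "symmetric_mat A"
  shows "(A *v x) \<bullet> y = x \<bullet> (A *v y)"
  using assms dot_lmul_matrix[of x A y]
  by (simp add: symmetric_mat_def flip: transpose_matrix_vector)

lemma GDERIV_reg_quadratic: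
  fixes A :: "real^'n^'n"
  assumes "2 \<le> p" "symmetric_mat A"
  shows "GDERIV (reg_quadratic p s A b) x :> A *v x - b + (s * norm x powr (p - 2)) *\<^sub>R x"
proof -
  have "((*v) A has_derivative (*v) A) (at x)"
    by (intro bounded_linear_imp_has_derivative) simp
  then have "((\<lambda>x. 1 / 2 * (x \<bullet> (A *v x))) has_derivative
      (\<lambda>h. 1 / 2 * (x \<bullet> (A *v h) + h \<bullet> (A *v x)))) (at x)"
    by (intro has_derivative_mult_right has_derivative_inner has_derivative_ident)
  moreover have "x \<bullet> (A *v h) = h \<bullet> (A *v x)" for h
    using symmetric_mat_inner[OF assms(2), of x h] by (simp add: inner_commute)
  ultimately have "GDERIV (\<lambda>x. 1 / 2 * (x \<bullet> (A *v x))) x :> A *v x"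
    by (simp add: gderiv_def)
  moreover have "GDERIV (\<lambda>x. b \<bullet> x) x :> b"
    unfolding gderiv_def inner_commute[of b]
    by (intro bounded_linear_imp_has_derivative bounded_linear_inner_left)
  moreover have "GDERIV (\<lambda>x. s / p * norm x powr p) x :> (s * norm x powr (p - 2)) *\<^sub>R x"
    using GDERIV_mult[OF GDERIV_const[of "s / p"] GDERIV_norm_powr[OF assms(1), of x]] assms
    by simp
  ultimately show ?thesis
    unfolding reg_quadratic_def[abs_def] by (intro GDERIV_add GDERIV_diff)
qed

lemma gradient_reg_quadratic:
  fixes A :: "real^'n^'n"
  assumes "2 \<le> p" "symmetric_mat A"
  shows "gradient (reg_quadratic p s A b) x = A *v x - b + (s * norm x powr (p - 2)) *\<^sub>R x"
  by (intro gradient_eqI GDERIV_reg_quadratic assms)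

text \<open>As the gradient vanishes at z, this is an inner product with a difference of gradients;
  the quadratic part contributes a nonnegative amount and uniform monotonicity bounds the
  rest.\<close>

lemma gradient_reg_quadratic_monotone:
  fixes A :: "real^'n^'n"
  assumes "2 \<le> p" "psd_mat A" "0 < s" "gradient (reg_quadratic p s A b) z = 0"
  shows "gradient (reg_quadratic p s A b) x \<bullet> (x - z) \<ge> s * 2 powr (2 - p) * norm (x - z) powr p"
proof -
  have sym: "symmetric_mat A" and "0 \<le> (x - z) \<bullet> (A *v (x - z))"
    using assms(2) by (auto simp: psd_mat_def)
  moreover have "gradient (reg_quadratic p s A b) x \<bullet> (x - z)
      = (gradient (reg_quadratic p s A b) x - gradient (reg_quadratic p s A b) z) \<bullet> (x - z)"
    using assms(4) by simp
  moreover have "\<dots> = (x - z) \<bullet> (A *v (x - z))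
      + s * ((norm x powr (p - 2) *\<^sub>R x - norm z powr (p - 2) *\<^sub>R z) \<bullet> (x - z))"
    unfolding gradient_reg_quadratic[OF assms(1) sym]
    by (simp add: matrix_vector_mult_diff_distrib algebra_simps inner_commute)
  moreover have "s * (2 powr (2 - p) * norm (x - z) powr p)
      \<le> s * ((norm x powr (p - 2) *\<^sub>R x - norm z powr (p - 2) *\<^sub>R z) \<bullet> (x - z))"
    using norm_powr_uniformly_monotone[OF assms(1), of x z] assms(3)
    by (intro mult_left_mono) auto
  ultimately show ?thesis
    by (simp add: mult.assoc)
qed

lemma norm_gradient_reg_quadratic_ge:
  fixes A :: "real^'n^'n"
  assumes "2 \<le> p" "psd_mat A" "0 < s" "gradient (reg_quadratic p s A b) z = 0"
  shows "norm (gradient (reg_quadratic p s A b) x) \<ge> s * 2 powr (2 - p) * norm (x - z) powr (p - 1)"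
proof (cases "x = z")
  case False
  have "s * 2 powr (2 - p) * norm (x - z) powr p
      \<le> norm (gradient (reg_quadratic p s A b) x) * norm (x - z)"
    using gradient_reg_quadratic_monotone[OF assms, of x] norm_cauchy_schwarz order_trans by blast
  moreover have "norm (x - z) powr p = norm (x - z) powr (p - 1) * norm (x - z)"
    using powr_mult_base[of "norm (x - z)" "p - 1"] by (simp add: mult.commute)
  ultimately show ?thesis
    using False by (simp flip: mult.assoc)
qed simp

text \<open>Monotonicity of the gradient, integrated along the segment from z to x; integrating
  t^(p-1) yields the factor 1/p.\<close>

lemma reg_quadratic_growth:
  fixes A :: "real^'n^'n"
  assumes "2 \<le> p" "psd_mat A" "0 < s" "gradient (reg_quadratic p s A b) z = 0"
  shows "reg_quadratic p s A b x - reg_quadratic p s A b z \<ge> s / p * 2 powr (2 - p) * norm (x - z) powr p"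
proof -
  let ?f = "reg_quadratic p s A b"
  define C where "C = s * 2 powr (2 - p) * norm (x - z) powr p"
  \<comment> \<open>The subtracted term has derivative C t^(p-1), exactly the lower bound for the
    slope of f along the segment, so that \<psi> is nondecreasing.\<close>
  define \<psi> where "\<psi> t = ?f (z + t *\<^sub>R (x - z)) - C / p * t powr p" for t :: real
  have sym: "symmetric_mat A"
    using assms(2) by (simp add: psd_mat_def)
  have line: "((\<lambda>t. ?f (z + t *\<^sub>R (x - z))) has_real_derivative
      gradient ?f (z + t *\<^sub>R (x - z)) \<bullet> (x - z)) (at t)" for t
  proof -
    have "(?f has_derivative (\<lambda>h. h \<bullet> gradient ?f (z + t *\<^sub>R (x - z)))) (at (z + t *\<^sub>R (x - z)))"
      using GDERIV_reg_quadratic[OF assms(1) sym, of s b]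
      by (simp add: gderiv_def gradient_reg_quadratic[OF assms(1) sym])
    moreover have "((\<lambda>t. z + t *\<^sub>R (x - z)) has_derivative (\<lambda>h. h *\<^sub>R (x - z))) (at t)"
      by (rule derivative_eq_intros | simp)+
    ultimately have "((\<lambda>t. ?f (z + t *\<^sub>R (x - z))) has_derivative
        (\<lambda>h. (h *\<^sub>R (x - z)) \<bullet> gradient ?f (z + t *\<^sub>R (x - z)))) (at t)"
      by (rule has_derivative_compose[rotated])
    then show ?thesis
      by (simp add: has_field_derivative_def inner_commute mult_commute_abs)
  qed
  have "\<psi> 0 \<le> \<psi> 1"
  proof (rule DERIV_nonneg_imp_increasing_open[of 0 1 \<psi>])
    fix t :: real assume t: "0 < t" "t < 1"
    have split: "t powr p = t powr (p - 1) * t"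
      using powr_mult_base[of t "p - 1"] t by (simp add: mult.commute)
    have "(\<psi> has_real_derivative gradient ?f (z + t *\<^sub>R (x - z)) \<bullet> (x - z) - C * t powr (p - 1)) (at t)"
      unfolding \<psi>_def by (rule derivative_eq_intros line has_real_derivative_powr | use t assms(1) in simp)+
    moreover have "C * t powr (p - 1) \<le> gradient ?f (z + t *\<^sub>R (x - z)) \<bullet> (x - z)"
    proof -
      \<comment> \<open>Monotonicity at the intermediate point involves the displacement t (x - z),
        hence an extra factor t on both sides, cancelled at the end.\<close>
      have "C * t powr (p - 1) * t = s * 2 powr (2 - p) * norm (z + t *\<^sub>R (x - z) - z) powr p"
        using t by (simp add: C_def powr_mult split)
      also have "\<dots> \<le> gradient ?f (z + t *\<^sub>R (x - z)) \<bullet> (x - z) * t"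
        using gradient_reg_quadratic_monotone[OF assms, of "z + t *\<^sub>R (x - z)"]
        by (simp add: mult.commute)
      finally show ?thesis
        using t by simp
    qed
    ultimately show "\<exists>y. (\<psi> has_real_derivative y) (at t) \<and> 0 \<le> y"
      by (meson diff_ge_0_iff_ge)
  next
    have "continuous_on {0..1} (\<lambda>t. ?f (z + t *\<^sub>R (x - z)))"
      by (intro continuous_at_imp_continuous_on ballI DERIV_isCont[OF line])
    moreover have "continuous_on {0..1} (\<lambda>t::real. t powr p)"
      using assms(1) by (intro continuous_on_powr' continuous_on_id continuous_on_const) auto
    ultimately show "continuous_on {0..1} \<psi>"
      unfolding \<psi>_def by (intro continuous_on_diff continuous_on_mult_left)
  qed simp
  then show ?thesis
    by (simp add: \<psi>_def C_def)
qed

section \<open>A resisting oracle\<close>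

text \<open>A total function of which only the first n values matter, so that vectors can be
  replaced by function update.\<close>

definition orthonormal_upto :: "nat \<Rightarrow> (nat \<Rightarrow> 'a::real_inner) \<Rightarrow> bool" where
  "orthonormal_upto n u \<longleftrightarrow> (\<forall>i<n. \<forall>j<n. u i \<bullet> u j = (if i = j then 1 else 0))"

lemma orthonormal_uptoD:
  "orthonormal_upto n u \<Longrightarrow> i < n \<Longrightarrow> j < n \<Longrightarrow> u i \<bullet> u j = (if i = j then 1 else 0)"
  by (simp add: orthonormal_upto_def)

lemma orthonormal_upto_inner_sum:
  assumes "orthonormal_upto n u" "i < n"
  shows "u i \<bullet> (\<Sum>j<n. a j *\<^sub>R u j) = a i"
proof -
  have "u i \<bullet> (\<Sum>j<n. a j *\<^sub>R u j) = (\<Sum>j<n. if i = j then a j else 0)"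
    unfolding inner_sum_right using assms by (intro sum.cong) (auto simp: orthonormal_upto_def)
  then show ?thesis
    using assms(2) by simp
qed

lemma norm_orthonormal_sum:
  assumes "orthonormal_upto n u"
  shows "(norm (\<Sum>j<n. a j *\<^sub>R u j))\<^sup>2 = (\<Sum>j<n. (a j)\<^sup>2)"
proof -
  have "(norm (\<Sum>j<n. a j *\<^sub>R u j))\<^sup>2 = (\<Sum>i<n. a i * (u i \<bullet> (\<Sum>j<n. a j *\<^sub>R u j)))"
    by (simp add: power2_norm_eq_inner inner_sum_left)
  then show ?thesis
    by (simp add: orthonormal_upto_inner_sum[OF assms] power2_eq_square)
qed

lemma orthonormal_upto_inner_span:
  assumes "orthonormal_upto l u" "x \<in> span (u ` {..<n})" "n \<le> i" "i < l"
  shows "u i \<bullet> x = 0"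
proof -
  have "orthogonal (u i) x"
    using assms(2)
    by (rule orthogonal_to_span) (use assms in \<open>auto simp: orthogonal_def orthonormal_upto_def\<close>)
  then show ?thesis
    by (simp add: orthogonal_def)
qed

text \<open>One Gram-Schmidt step, which also has to produce a new vector when x already lies in the
  span.\<close>

lemma orthonormal_upto_extend_vector:
  fixes x :: "'a::euclidean_space"
  assumes "orthonormal_upto n u" "n < DIM('a)"
  shows "\<exists>v. orthonormal_upto (Suc n) (u(n := v)) \<and> x \<in> span ((u(n := v)) ` {..<Suc n})"
proof -
  define S where "S = span (u ` {..<n})"
  define z where "z = (\<Sum>i<n. (u i \<bullet> x) *\<^sub>R u i)"
  have z: "z \<in> S"
    unfolding z_def S_def by (intro span_sum span_scale span_base) auto
  \<comment> \<open>The new direction before normalization: the residual of x, or, if that vanishes,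
    any nonzero vector orthogonal to the span, which exists since n is below the dimension.\<close>
  obtain w where w: "w \<noteq> 0" "\<And>i. i < n \<Longrightarrow> u i \<bullet> w = 0" "x - z \<in> range (\<lambda>k. k *\<^sub>R w)"
  proof (cases "x = z")
    case True
    have "dim (u ` {..<n}) \<le> n"
      using dim_le_card[of "u ` {..<n}" "u ` {..<n}"] card_image_le[of "{..<n}" u]
      by (simp add: span_superset)
    then have "dim (u ` {..<n}) < DIM('a)"
      using assms(2) by simp
    then obtain w where "w \<noteq> 0" "\<And>y. y \<in> S \<Longrightarrow> orthogonal y w"
      using orthogonal_to_subspace_exists[of "u ` {..<n}"] by (metis S_def orthogonal_commute)
    moreover have "u i \<in> S" if "i < n" for i
      using that by (auto simp: S_def intro: span_base)
    ultimately show ?thesis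
      using True by (intro that[of w]) (auto simp: orthogonal_def intro!: image_eqI[of _ _ 0])
  next
    case False
    then show ?thesis
      using orthonormal_upto_inner_sum[OF assms(1)]
      by (intro that[of "x - z"]) (auto simp: z_def inner_diff_right intro!: image_eqI[of _ _ 1])
  qed
  define v where "v = sgn w"
  have v: "v \<bullet> v = 1" "\<And>i. i < n \<Longrightarrow> u i \<bullet> v = 0"
    using w(1,2) by (simp_all add: v_def norm_sgn flip: power2_norm_eq_inner) (simp add: sgn_div_norm)
  have "(u(n := v)) ` {..<Suc n} = insert v (u ` {..<n})"
    by (auto simp: image_iff less_Suc_eq)
  moreover have "x \<in> span (insert v (u ` {..<n}))"
  proof -
    obtain k where "x - z = k *\<^sub>R w"
      using w(3) by auto
    then have "x = z + (k * norm w) *\<^sub>R v"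
      using w(1) by (simp add: v_def sgn_div_norm algebra_simps)
    moreover have "z \<in> span (insert v (u ` {..<n}))"
      using z span_mono[of "u ` {..<n}" "insert v (u ` {..<n})"] by (auto simp: S_def)
    ultimately show ?thesis
      by (metis insertI1 span_add span_base span_scale)
  qed
  moreover have "orthonormal_upto (Suc n) (u(n := v))"
    using assms(1) v by (auto simp: orthonormal_upto_def less_Suc_eq inner_commute)
  ultimately show ?thesis
    by metis
qed

lemma orthonormal_upto_extend:
  fixes u :: "nat \<Rightarrow> 'a::euclidean_space"
  assumes "n \<le> l" "orthonormal_upto n u" "l \<le> DIM('a)"
  shows "\<exists>u'. orthonormal_upto l u' \<and> (\<forall>j<n. u' j = u j)"
  using assms(1,3)
proof (induction l rule: dec_induct)
  case base
  then show ?case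
    using assms(2) by blast
next
  case (step l)
  then obtain u' where u': "orthonormal_upto l u'" "\<forall>j<n. u' j = u j"
    by auto
  obtain v where "orthonormal_upto (Suc l) (u'(l := v))"
    using orthonormal_upto_extend_vector[OF u'(1)] step.prems by (metis Suc_le_eq)
  moreover have "\<forall>j<n. (u'(l := v)) j = u j"
    using u'(2) step.hyps by auto
  ultimately show ?case
    by blast
qed

text \<open>Slot n absorbs the query point x; later slots are filled arbitrarily and may be chosen
  anew at the next query.\<close>

lemma orthonormal_upto_adapt:
  fixes x :: "'a::euclidean_space"
  assumes "orthonormal_upto n u" "n < l" "l \<le> DIM('a)"
  shows "\<exists>u'. orthonormal_upto l u' \<and> (\<forall>j<n. u' j = u j) \<and> x \<in> span (u' ` {..<Suc n})"
proof -
  obtain v where v: "orthonormal_upto (Suc n) (u(n := v))" "x \<in> span ((u(n := v)) ` {..<Suc n})"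
    using orthonormal_upto_extend_vector[OF assms(1)] assms by (meson less_le_trans)
  then obtain u' where u': "orthonormal_upto l u'" "\<forall>j<Suc n. u' j = (u(n := v)) j"
    using orthonormal_upto_extend[of "Suc n" l] assms by (metis Suc_leI)
  have "u' ` {..<Suc n} = (u(n := v)) ` {..<Suc n}"
    using u'(2) by (intro image_cong) auto
  then show ?thesis
    using u' v(2) by (intro exI[of _ u']) auto
qed

text \<open>Determinism of the method. The oracles are compared at the iterates for f only; the
  induction shows these to be the iterates for g too.\<close>

lemma iterate_cong:
  assumes "\<And>j. j < k \<Longrightarrow> fo_info f (iterate M f j) = fo_info g (iterate M f j)"
  shows "iterate M f k = iterate M g k"
  using assms
proof (induction k rule: less_induct)
  case (less k)
  show ?case
  proof (cases k)
    case (Suc i)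
    have "fo_info f (iterate M f j) = fo_info g (iterate M g j)" if "j < Suc i" for j
      using less.IH[of j] less.prems[of j] less.prems that Suc by simp
    then show ?thesis
      unfolding Suc iterate.simps by (intro arg_cong[of _ _ "M i"] map_cong) auto
  qed simp
qed

text \<open>Each query reveals at most one new direction and each answer one more, and both can still
  be placed into the family since the answers so far depend only on the vectors already fixed.\<close>

lemma resisting_oracle:
  fixes f :: "(nat \<Rightarrow> 'a::euclidean_space) \<Rightarrow> 'a \<Rightarrow> real"
  assumes dim: "2 * N < DIM('a)"
    and info: "\<And>u u' n x. \<lbrakk>orthonormal_upto (Suc (2 * N)) u; orthonormal_upto (Suc (2 * N)) u'; n \<le> 2 * N;
      \<forall>j\<le>n. u j = u' j; x \<in> span (u ` {..<n})\<rbrakk> \<Longrightarrow> fo_info (f u) x = fo_info (f u') x"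
  shows "\<exists>u. orthonormal_upto (Suc (2 * N)) u \<and> iterate M (f u) N \<in> span (u ` {..<2 * N})"
proof -
  have "\<exists>u. orthonormal_upto (Suc (2 * N)) u \<and> (\<forall>i\<le>k. iterate M (f u) i \<in> span (u ` {..<2 * i}))"
    if "k \<le> N" for k
    using that
  proof (induction k)
    case 0
    obtain u :: "nat \<Rightarrow> 'a" where "orthonormal_upto (Suc (2 * N)) u"
      using orthonormal_upto_extend[of 0 "Suc (2 * N)" "\<lambda>_. 0::'a"] dim
      by (auto simp: orthonormal_upto_def[of 0])
    then show ?case
      by auto
  next
    case (Suc k)
    then obtain u where u: "orthonormal_upto (Suc (2 * N)) u"
      "\<And>i. i \<le> k \<Longrightarrow> iterate M (f u) i \<in> span (u ` {..<2 * i})"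
      by auto
    \<comment> \<open>The answers to queries 0, ..., k involve only the vectors with index at most
      2k. These are kept, and the vector with index 2k + 1 is chosen anew to capture the next
      iterate.\<close>
    have "orthonormal_upto (Suc (2 * k)) u"
      using u(1) Suc.prems by (auto simp: orthonormal_upto_def)
    then obtain u' where u': "orthonormal_upto (Suc (2 * N)) u'" "\<And>j. j < Suc (2 * k) \<Longrightarrow> u' j = u j"
      "iterate M (f u) (Suc k) \<in> span (u' ` {..<Suc (Suc (2 * k))})"
      using orthonormal_upto_adapt[of "Suc (2 * k)" u "Suc (2 * N)" "iterate M (f u) (Suc k)"] dim Suc.prems
      by (metis Suc_le_eq Suc_less_eq mult_less_cancel2 mult.commute pos2)
    have same: "iterate M (f u') i = iterate M (f u) i" if "i \<le> Suc k" for i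
    proof (rule iterate_cong[symmetric])
      fix j assume "j < i"
      then show "fo_info (f u) (iterate M (f u) j) = fo_info (f u') (iterate M (f u) j)"
        using u u' that Suc.prems by (intro info[of _ _ "2 * j"]) auto
    qed
    have "iterate M (f u') i \<in> span (u' ` {..<2 * i})" if "i \<le> Suc k" for i
    proof (cases "i = Suc k")
      case True
      then show ?thesis
        using u'(3) same[of "Suc k"] by simp
    next
      case False
      then have "u' ` {..<2 * i} = u ` {..<2 * i}"
        using that u'(2) by (intro image_cong) auto
      then show ?thesis
        using same[OF that] u(2)[of i] that False by simp
    qed
    then show ?case
      using u'(1) by blast
  qed
  then show ?thesis
    by blast
qed

section \<open>The Chebyshev chain\<close>

lemma tridiagonal_sum:
  fixes f :: "nat \<Rightarrow> real"
  assumes "i \<le> m"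
  shows "(\<Sum>j\<le>m. if i = j then a * f j else if i = Suc j \<or> j = Suc i then b * f j else 0)
    = a * f i + b * ((if 0 < i then f (i - 1) else 0) + (if i < m then f (Suc i) else 0))"
proof -
  have "(\<Sum>j\<le>m. if i = j then a * f j else if i = Suc j \<or> j = Suc i then b * f j else 0)
      = (\<Sum>j\<le>m. (if i = j then a * f j else 0) + (if j = i - 1 then (if 0 < i then b * f j else 0) else 0)
          + (if j = Suc i then b * f j else 0))"
    by (intro sum.cong) auto
  also have "\<dots> = a * f i + (if 0 < i then b * f (i - 1) else 0) + (if i < m then b * f (Suc i) else 0)"
    using assms by (simp add: sum.distrib Suc_le_eq)
  finally show ?thesis
    by (simp add: algebra_simps)
qed

text \<open>The intended spectrum has half-width c and centre c cosh \<theta>; its ends are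
  \<open>\<nu>\<close> and \<open>\<Lambda>\<close> below.\<close>

locale chebyshev_chain =
  fixes m :: nat and c \<theta> :: real
  assumes m_pos: "0 < m" and c_pos: "0 < c" and \<theta>_pos: "0 < \<theta>"
begin

text \<open>Trapezoidal weights: halving the ends compensates for the missing neighbour there, which
  makes the constant and the alternating sequence exact eigenvectors.\<close>

definition wt :: "nat \<Rightarrow> real" where
  "wt i = (if i = 0 \<or> i = m then 1 / 2 else 1)"

text \<open>The coefficients form a Cholesky factor of the tridiagonal Gram matrix of \<open>chain_vec_Gram\<close> below. The
  recurrence \<open>T\<^sub>i\<^sub>+\<^sub>1 + T\<^sub>i\<^sub>-\<^sub>1 = 2 cosh \<theta> T\<^sub>i\<close> with \<open>T\<^sub>i = cosh (i \<theta>)\<close> makes the factorization close up.\<close>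

definition diagonal :: "nat \<Rightarrow> real" where
  "diagonal i = sqrt (c / 2 * (if i < m then cosh (real (Suc i) * \<theta>) / cosh (real i * \<theta>)
     else sinh (real m * \<theta>) * sinh \<theta> / cosh (real m * \<theta>)))"

definition subdiagonal :: "nat \<Rightarrow> real" where
  "subdiagonal i = (if i = 0 then 0 else sqrt (c / 2 * (cosh (real (i - 1) * \<theta>) / cosh (real i * \<theta>))))"

text \<open>At i = 0 the subdiagonal coefficient is 0, which removes the spurious term with the
  truncated index \<open>0 - 1\<close>.\<close>

definition chain_vec :: "(nat \<Rightarrow> 'a::real_inner) \<Rightarrow> nat \<Rightarrow> 'a" where
  "chain_vec u i = diagonal i *\<^sub>R u i - subdiagonal i *\<^sub>R u (i - 1)"

definition \<nu> :: real where "\<nu> = c * (cosh \<theta> - 1)"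

definition \<Lambda> :: real where "\<Lambda> = c * (cosh \<theta> + 1)"

text \<open>Each \<open>chain_vec\<close> involves two consecutive vectors, so the first sum is
  tridiagonal in the family. On the orthogonal complement of the family the operator is
  \<open>\<nu>\<close> times the identity, which keeps the spectrum within its bounds.\<close>

definition chain_op :: "(nat \<Rightarrow> 'a::real_inner) \<Rightarrow> 'a \<Rightarrow> 'a" where
  "chain_op u x = (\<Sum>i\<le>m. ((chain_vec u i \<bullet> x) / wt i) *\<^sub>R chain_vec u i)
     + \<nu> *\<^sub>R (x - (\<Sum>i\<le>m. (u i \<bullet> x) *\<^sub>R u i))"

section \<open>The tridiagonal Gram matrix of the chain vectors\<close>

lemma wt_pos: "0 < wt i"
  by (simp add: wt_def)

lemma \<nu>_pos: "0 < \<nu>"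
  using c_pos \<theta>_pos cosh_real_ge_1[of \<theta>] by (simp add: \<nu>_def order.strict_iff_order)

lemma \<Lambda>_pos: "0 < \<Lambda>"
  using c_pos by (simp add: \<Lambda>_def add_pos_pos)

lemma \<nu>_less_\<Lambda>: "\<nu> < \<Lambda>"
  using c_pos by (simp add: \<nu>_def \<Lambda>_def)

lemma diagonal_pos: "0 < diagonal i"
  using m_pos c_pos \<theta>_pos by (simp add: diagonal_def)

text \<open>The two quotients of hyperbolic cosines are reciprocal to each other.\<close>

lemma diagonal_mult_subdiagonal: "i < m \<Longrightarrow> diagonal i * subdiagonal (Suc i) = c / 2"
  using c_pos real_sqrt_unique[of "c / 2" "c * c / 4"]
  by (simp add: diagonal_def subdiagonal_def power2_eq_square flip: real_sqrt_mult)

text \<open>With B and S as below, the addition formulas give cosh ((i \<plusminus> 1) \<theta>) = B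
  cosh \<theta> \<plusminus> S. In the interior S cancels between the two squares; at i = m the
  diagonal square is c/2 * S/B, which leaves half the value, and at i = 0 the subdiagonal is
  absent.\<close>

lemma diagonal_subdiagonal_squares:
  assumes "i \<le> m"
  shows "(diagonal i)\<^sup>2 + (subdiagonal i)\<^sup>2 = c * cosh \<theta> * wt i"
proof (cases "i = 0")
  case True
  then show ?thesis
    using c_pos m_pos by (simp add: diagonal_def subdiagonal_def wt_def)
next
  case False
  define S where "S = sinh (real i * \<theta>) * sinh \<theta>"
  define B where "B = cosh (real i * \<theta>)"
  have up: "cosh ((1 + real i) * \<theta>) = B * cosh \<theta> + S"
    unfolding B_def S_def cosh_add[symmetric] by (simp add: algebra_simps)
  have down: "cosh ((real i - 1) * \<theta>) = B * cosh \<theta> - S"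
    unfolding B_def S_def cosh_diff[symmetric] by (simp add: algebra_simps)
  have B: "0 < B"
    by (simp add: B_def)
  have sub: "(subdiagonal i)\<^sup>2 = c / 2 * ((B * cosh \<theta> - S) / B)"
    using False c_pos B by (simp add: subdiagonal_def flip: down B_def)
  show ?thesis
  proof (cases "i = m")
    case True
    have "(diagonal i)\<^sup>2 = c / 2 * (S / B)"
      using c_pos \<theta>_pos by (simp add: diagonal_def S_def B_def True)
    then have "(diagonal i)\<^sup>2 + (subdiagonal i)\<^sup>2 = c / 2 * (S / B + (B * cosh \<theta> - S) / B)"
      by (simp only: sub distrib_left)
    also have "S / B + (B * cosh \<theta> - S) / B = cosh \<theta>"
      using B by (simp add: field_simps)
    finally show ?thesis
      using True by (simp add: wt_def)
  next
    case neq: False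
    then have "(diagonal i)\<^sup>2 = c / 2 * ((B * cosh \<theta> + S) / B)"
      using c_pos assms B by (simp add: diagonal_def flip: up B_def)
    then show ?thesis
      using B False neq by (simp add: sub wt_def field_simps)
  qed
qed

lemma chain_vec_Gram:
  assumes "orthonormal_upto (Suc m) u" "i \<le> m" "j \<le> m"
  shows "chain_vec u i \<bullet> chain_vec u j
    = (if i = j then c * cosh \<theta> * wt i else if i = Suc j \<or> j = Suc i then - (c / 2) else 0)"
proof -
  have *: "chain_vec u i \<bullet> chain_vec u j
    = (if i = j then c * cosh \<theta> * wt i else if j = Suc i then - (c / 2) else 0)"
    if "i \<le> j" "j \<le> m" for i j
  proof -
    have "chain_vec u i \<bullet> chain_vec u j = diagonal i * diagonal j * (u i \<bullet> u j)
        - diagonal i * subdiagonal j * (u i \<bullet> u (j - 1)) - subdiagonal i * diagonal j * (u (i - 1) \<bullet> u j)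
        + subdiagonal i * subdiagonal j * (u (i - 1) \<bullet> u (j - 1))"
      by (simp add: chain_vec_def algebra_simps)
    also have "\<dots> = (if i = j then (diagonal i)\<^sup>2 + (subdiagonal i)\<^sup>2
        else if j = Suc i then - (diagonal i * subdiagonal (Suc i)) else 0)"
      using that by (cases "i = 0"; cases "j = 0")
        (auto simp: orthonormal_uptoD[OF assms(1)] power2_eq_square subdiagonal_def[of 0])
    finally show ?thesis
      using that by (simp add: diagonal_subdiagonal_squares diagonal_mult_subdiagonal)
  qed
  show ?thesis
    using *[of i j] *[of j i] assms(2,3) by (cases i j rule: le_cases) (auto simp: inner_commute)
qed

lemma chain_vec_inner_sum:
  assumes "orthonormal_upto (Suc m) u" "i \<le> m"
  shows "chain_vec u i \<bullet> (\<Sum>j\<le>m. Y j *\<^sub>R chain_vec u j) = c * cosh \<theta> * wt i * Y i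
    - c / 2 * ((if 0 < i then Y (i - 1) else 0) + (if i < m then Y (Suc i) else 0))"
proof -
  have "chain_vec u i \<bullet> (\<Sum>j\<le>m. Y j *\<^sub>R chain_vec u j)
      = (\<Sum>j\<le>m. if i = j then c * cosh \<theta> * wt i * Y j
          else if i = Suc j \<or> j = Suc i then - (c / 2) * Y j else 0)"
    unfolding inner_sum_right
    by (intro sum.cong) (auto simp: chain_vec_Gram[OF assms(1,2)])
  then show ?thesis
    using tridiagonal_sum[OF assms(2), of "c * cosh \<theta> * wt i" Y "- (c / 2)"] by simp
qed

text \<open>Distributes the weighted sum over the m neighbouring pairs, to be compared termwise with
  the m products in \<open>norm_chain_sum\<close>.\<close>

lemma sum_wt:
  fixes F :: "nat \<Rightarrow> real"
  shows "(\<Sum>i\<le>m. wt i * F i) = (\<Sum>i<m. F i + F (Suc i)) / 2"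
proof -
  have "(\<Sum>i\<le>m. wt i * F i)
      = (\<Sum>i\<le>m. F i - (if i = 0 then F 0 / 2 else 0) - (if i = m then F m / 2 else 0))"
    using m_pos by (intro sum.cong) (auto simp: wt_def)
  also have "\<dots> = (\<Sum>i\<le>m. F i) - F 0 / 2 - F m / 2"
    by (simp add: sum_subtractf)
  finally show ?thesis
    using sum.atMost_shift[of F m] sum.lessThan_Suc[of F m]
    by (simp add: sum.distrib lessThan_Suc_atMost)
qed

lemma norm_chain_sum:
  assumes "orthonormal_upto (Suc m) u"
  shows "(norm (\<Sum>j\<le>m. Y j *\<^sub>R chain_vec u j))\<^sup>2
    = c * cosh \<theta> * (\<Sum>i\<le>m. wt i * (Y i)\<^sup>2) - c * (\<Sum>i<m. Y i * Y (Suc i))"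
proof -
  define P where "P = (\<Sum>i<m. Y i * Y (Suc i))"
  have "(\<Sum>i\<le>m. Y i * (if 0 < i then Y (i - 1) else 0)) = P"
    by (simp add: P_def sum.atMost_shift mult.commute)
  moreover have "(\<Sum>i\<le>m. Y i * (if i < m then Y (Suc i) else 0)) = P"
    unfolding P_def lessThan_Suc_atMost[symmetric] sum.lessThan_Suc by simp
  ultimately have P: "(\<Sum>i\<le>m. Y i * ((if 0 < i then Y (i - 1) else 0) + (if i < m then Y (Suc i) else 0))) = 2 * P"
    by (simp only: distrib_left sum.distrib)
  have "(norm (\<Sum>j\<le>m. Y j *\<^sub>R chain_vec u j))\<^sup>2
      = (\<Sum>i\<le>m. Y i * (chain_vec u i \<bullet> (\<Sum>j\<le>m. Y j *\<^sub>R chain_vec u j)))"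
    by (simp add: power2_norm_eq_inner inner_sum_left)
  also have "\<dots> = (\<Sum>i\<le>m. c * cosh \<theta> * (wt i * (Y i)\<^sup>2)
      - c / 2 * (Y i * ((if 0 < i then Y (i - 1) else 0) + (if i < m then Y (Suc i) else 0))))"
    by (intro sum.cong refl, subst chain_vec_inner_sum[OF assms])
      (simp_all add: algebra_simps power2_eq_square)
  also have "\<dots> = c * cosh \<theta> * (\<Sum>i\<le>m. wt i * (Y i)\<^sup>2) - c / 2 * (2 * P)"
    unfolding sum_subtractf P[symmetric] by (simp only: sum_distrib_left)
  finally show ?thesis
    by (simp add: P_def)
qed

text \<open>Each product of neighbours is, up to sign, at most the mean of the two squares; by
  \<open>sum_wt\<close> these means add up to the weighted sum of squares.\<close>

lemma norm_chain_sum_bounds: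
  assumes "orthonormal_upto (Suc m) u"
  shows "\<nu> * (\<Sum>i\<le>m. wt i * (Y i)\<^sup>2) \<le> (norm (\<Sum>j\<le>m. Y j *\<^sub>R chain_vec u j))\<^sup>2"
    and "(norm (\<Sum>j\<le>m. Y j *\<^sub>R chain_vec u j))\<^sup>2 \<le> \<Lambda> * (\<Sum>i\<le>m. wt i * (Y i)\<^sup>2)"
proof -
  have prod: "Y i * Y (Suc i) \<le> ((Y i)\<^sup>2 + (Y (Suc i))\<^sup>2) / 2"
    "- (Y i * Y (Suc i)) \<le> ((Y i)\<^sup>2 + (Y (Suc i))\<^sup>2) / 2" for i
    using sum_squares_bound[of "Y i" "Y (Suc i)"] sum_squares_bound[of "- Y i" "Y (Suc i)"] by simp_all
  have "(\<Sum>i<m. Y i * Y (Suc i)) \<le> (\<Sum>i\<le>m. wt i * (Y i)\<^sup>2)"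
    unfolding sum_wt sum_divide_distrib by (intro sum_mono prod)
  moreover have "- (\<Sum>i<m. Y i * Y (Suc i)) \<le> (\<Sum>i\<le>m. wt i * (Y i)\<^sup>2)"
    unfolding sum_wt sum_divide_distrib sum_negf[symmetric] by (intro sum_mono prod)
  ultimately have "c * (\<Sum>i<m. Y i * Y (Suc i)) \<le> c * (\<Sum>i\<le>m. wt i * (Y i)\<^sup>2)"
    "c * - (\<Sum>i<m. Y i * Y (Suc i)) \<le> c * (\<Sum>i\<le>m. wt i * (Y i)\<^sup>2)"
    using c_pos by (auto simp only: mult_le_cancel_left_pos)
  then show "\<nu> * (\<Sum>i\<le>m. wt i * (Y i)\<^sup>2) \<le> (norm (\<Sum>j\<le>m. Y j *\<^sub>R chain_vec u j))\<^sup>2"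
    "(norm (\<Sum>j\<le>m. Y j *\<^sub>R chain_vec u j))\<^sup>2 \<le> \<Lambda> * (\<Sum>i\<le>m. wt i * (Y i)\<^sup>2)"
    unfolding norm_chain_sum[OF assms] \<nu>_def \<Lambda>_def by (simp_all add: algebra_simps)
qed

section \<open>The chain operator and its spectrum\<close>

lemma chain_vec_span: "i \<le> n \<Longrightarrow> chain_vec u i \<in> span (u ` {..n})"
  unfolding chain_vec_def by (intro span_diff span_scale span_base) auto

lemma chain_op_linear: "linear (chain_op u)"
proof (rule linearI)
  fix x y :: 'a and k :: real
  show "chain_op u (x + y) = chain_op u x + chain_op u y"
    by (simp add: chain_op_def inner_add_right add_divide_distrib algebra_simps sum.distrib)
  show "chain_op u (k *\<^sub>R x) = k *\<^sub>R chain_op u x"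
    by (simp add: chain_op_def scaleR_right_distrib scaleR_right_diff_distrib scaleR_sum_right mult.left_commute)
qed

lemma chain_op_inner:
  "chain_op u x \<bullet> y = (\<Sum>i\<le>m. (chain_vec u i \<bullet> x) * (chain_vec u i \<bullet> y) / wt i)
     + \<nu> * (x \<bullet> y - (\<Sum>i\<le>m. (u i \<bullet> x) * (u i \<bullet> y)))"
  by (simp add: chain_op_def inner_add_left inner_diff_left inner_sum_left)

lemma chain_op_self_adjoint: "chain_op u x \<bullet> y = x \<bullet> chain_op u y"
  unfolding inner_commute[of x] chain_op_inner by (simp add: mult.commute inner_commute[of y])

lemma expansion_in_span:
  assumes "orthonormal_upto (Suc m) u" "x \<in> span (u ` {..m})"
  shows "(\<Sum>i\<le>m. (u i \<bullet> x) *\<^sub>R u i) = x"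
  using assms(2)
proof (induction rule: span_induct_alt)
  case (step k v y)
  then obtain l where l: "v = u l" "l \<le> m"
    by auto
  have "(\<Sum>i\<le>m. (u i \<bullet> (k *\<^sub>R v)) *\<^sub>R u i) = (\<Sum>i\<le>m. if i = l then k *\<^sub>R u l else 0)"
    using l by (intro sum.cong) (auto simp: orthonormal_uptoD[OF assms(1)])
  also have "\<dots> = k *\<^sub>R v"
    using l by simp
  finally show ?case
    using step.IH by (simp only: inner_add_right scaleR_left_distrib sum.distrib)
qed simp

text \<open>Forward substitution in a bidiagonal system with positive diagonal.\<close>

lemma vector_in_chain:
  assumes "i \<le> m"
  shows "\<exists>Y. u i = (\<Sum>j\<le>m. Y j *\<^sub>R chain_vec u j)"
  using assms
proof (induction i)
  case 0
  show ?case
    using diagonal_pos[of 0] by (intro exI[of _ "\<lambda>j. if j = 0 then 1 / diagonal 0 else 0"])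
      (simp add: if_distrib[of "\<lambda>k. k *\<^sub>R _"] chain_vec_def subdiagonal_def cong: if_cong)
next
  case (Suc i)
  then obtain Y where Y: "u i = (\<Sum>j\<le>m. Y j *\<^sub>R chain_vec u j)"
    by auto
  have "(\<Sum>j\<le>m. (if j = Suc i then 1 else 0) *\<^sub>R chain_vec u j) = chain_vec u (Suc i)"
    using Suc.prems by (simp add: if_distrib[of "\<lambda>k. k *\<^sub>R _"] cong: if_cong)
  then have comb: "diagonal (Suc i) *\<^sub>R u (Suc i)
      = (\<Sum>j\<le>m. (subdiagonal (Suc i) * Y j + (if j = Suc i then 1 else 0)) *\<^sub>R chain_vec u j)"
    by (simp add: scaleR_left_distrib sum.distrib Y scaleR_sum_right chain_vec_def[of u "Suc i"] flip: scaleR_scaleR)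
  then have "u (Suc i) = (1 / diagonal (Suc i)) *\<^sub>R
      (\<Sum>j\<le>m. (subdiagonal (Suc i) * Y j + (if j = Suc i then 1 else 0)) *\<^sub>R chain_vec u j)"
    using diagonal_pos[of "Suc i"] by (simp flip: comb)
  then show ?case
    unfolding scaleR_sum_right scaleR_scaleR
    by (intro exI[of _ "\<lambda>j. 1 / diagonal (Suc i) * (subdiagonal (Suc i) * Y j + (if j = Suc i then 1 else 0))"])
qed

lemma span_in_chain:
  assumes "x \<in> span (u ` {..m})"
  shows "\<exists>Y. x = (\<Sum>j\<le>m. Y j *\<^sub>R chain_vec u j)"
  using assms
proof (induction rule: span_induct_alt)
  case base
  show ?case
    by (intro exI[of _ "\<lambda>_. 0"]) simp
next
  case (step k v y)
  then obtain X Y where "v = (\<Sum>j\<le>m. X j *\<^sub>R chain_vec u j)" "y = (\<Sum>j\<le>m. Y j *\<^sub>R chain_vec u j)"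
    using vector_in_chain by blast
  then have "k *\<^sub>R v + y = (\<Sum>j\<le>m. (k * X j + Y j) *\<^sub>R chain_vec u j)"
    by (simp add: scaleR_sum_right scaleR_left_distrib sum.distrib)
  then show ?case
    by (intro exI[of _ "\<lambda>j. k * X j + Y j"])
qed


text \<open>The bounds for the Gram matrix are transferred to the operator by duality. On the
  orthogonal complement of the family the operator is a multiple of the identity, so only the
  projection z of x matters.\<close>

lemma chain_op_bounds:
  assumes "orthonormal_upto (Suc m) u"
  shows "\<nu> * (x \<bullet> x) \<le> x \<bullet> chain_op u x" and "x \<bullet> chain_op u x \<le> \<Lambda> * (x \<bullet> x)"
proof -
  define z where "z = (\<Sum>i\<le>m. (u i \<bullet> x) *\<^sub>R u i)"
  define S where "S = (\<Sum>i\<le>m. (chain_vec u i \<bullet> x)\<^sup>2 / wt i)"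
  have z_span: "z \<in> span (u ` {..m})"
    unfolding z_def by (intro span_sum span_scale span_base) auto
  have uz: "u i \<bullet> z = u i \<bullet> x" if "i \<le> m" for i
    using orthonormal_upto_inner_sum[OF assms, of i "\<lambda>i. u i \<bullet> x"] that
    by (simp add: z_def lessThan_Suc_atMost)
  have Wz: "chain_vec u i \<bullet> z = chain_vec u i \<bullet> x" if "i \<le> m" for i
    using that by (simp add: chain_vec_def inner_diff_left uz)
  have zz: "z \<bullet> z = (\<Sum>i\<le>m. (u i \<bullet> x)\<^sup>2)"
    using norm_orthonormal_sum[OF assms, of "\<lambda>i. u i \<bullet> x"]
    by (simp add: z_def lessThan_Suc_atMost power2_norm_eq_inner)
  have op: "x \<bullet> chain_op u x = S + \<nu> * (x \<bullet> x - z \<bullet> z)"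
    by (simp add: inner_commute[of x "chain_op u x"] chain_op_inner S_def zz power2_eq_square)
  have "x \<bullet> z = z \<bullet> z"
    by (simp add: zz) (simp add: z_def inner_sum_right power2_eq_square inner_commute)
  then have zx: "z \<bullet> z \<le> x \<bullet> x"
    using inner_ge_zero[of "x - z"] by (simp add: inner_diff_left inner_diff_right inner_commute)
  have lo: "\<nu> * (z \<bullet> z) \<le> S"
  proof -
    obtain Y where Y: "z = (\<Sum>i\<le>m. Y i *\<^sub>R chain_vec u i)"
      using span_in_chain[OF z_span] by blast
    \<comment> \<open>Young's inequality weighted so that the first terms sum to at most z \<bullet>
      z, by the lower Gram bound.\<close>
    have pw: "2 * (Y i * t) \<le> \<nu> * (wt i * (Y i)\<^sup>2) + t\<^sup>2 / wt i / \<nu>" for i t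
    proof -
      have "0 \<le> (\<nu> * wt i * Y i - t)\<^sup>2 / (\<nu> * wt i)"
        using \<nu>_pos wt_pos[of i] by simp
      also have "\<dots> = \<nu> * (wt i * (Y i)\<^sup>2) + t\<^sup>2 / wt i / \<nu> - 2 * (Y i * t)"
        using \<nu>_pos wt_pos[of i] by (simp add: field_simps power2_eq_square)
      finally show ?thesis
        by simp
    qed
    have "z \<bullet> z = (\<Sum>i\<le>m. Y i * (chain_vec u i \<bullet> x))"
      by (subst Y) (simp add: inner_sum_left Wz)
    then have "2 * (z \<bullet> z) \<le> (\<Sum>i\<le>m. \<nu> * (wt i * (Y i)\<^sup>2) + (chain_vec u i \<bullet> x)\<^sup>2 / wt i / \<nu>)"
      by (simp only: sum_distrib_left) (intro sum_mono pw)
    also have "\<dots> = \<nu> * (\<Sum>i\<le>m. wt i * (Y i)\<^sup>2) + S / \<nu>"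
      by (simp add: S_def sum.distrib sum_distrib_left sum_divide_distrib)
    also have "\<dots> \<le> z \<bullet> z + S / \<nu>"
      using norm_chain_sum_bounds(1)[OF assms, of Y] by (simp add: Y power2_norm_eq_inner)
    finally show ?thesis
      using \<nu>_pos by (simp add: field_simps)
  qed
  have hi: "S \<le> \<Lambda> * (z \<bullet> z)"
  proof -
    define Y where "Y i = (chain_vec u i \<bullet> x) / wt i" for i
    \<comment> \<open>This is the image of z under the operator; expanding the square of \<Lambda> z
      - g and bounding g \<bullet> g by \<Lambda> S gives the claim.\<close>
    define g where "g = (\<Sum>i\<le>m. Y i *\<^sub>R chain_vec u i)"
    have "(\<Sum>i\<le>m. wt i * (Y i)\<^sup>2) = S"
      using wt_pos by (simp add: S_def Y_def power_divide power2_eq_square less_imp_neq[THEN not_sym])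
    then have "g \<bullet> g \<le> \<Lambda> * S"
      using norm_chain_sum_bounds(2)[OF assms, of Y] by (simp add: g_def power2_norm_eq_inner)
    moreover have "z \<bullet> g = S"
      by (simp add: g_def S_def Y_def inner_sum_right inner_commute[of z] Wz power2_eq_square)
    moreover have "0 \<le> (\<Lambda> *\<^sub>R z - g) \<bullet> (\<Lambda> *\<^sub>R z - g)"
      by simp
    ultimately have "0 \<le> \<Lambda> * (\<Lambda> * (z \<bullet> z) - S)"
      by (simp add: inner_diff_left inner_diff_right inner_commute algebra_simps)
    then show ?thesis
      using \<Lambda>_pos by (simp add: zero_le_mult_iff)
  qed
  show "\<nu> * (x \<bullet> x) \<le> x \<bullet> chain_op u x"
    unfolding op using lo by (simp add: algebra_simps)
  have "\<nu> * (x \<bullet> x - z \<bullet> z) \<le> \<Lambda> * (x \<bullet> x - z \<bullet> z)"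
    using zx \<nu>_less_\<Lambda> by (intro mult_right_mono) auto
  then show "x \<bullet> chain_op u x \<le> \<Lambda> * (x \<bullet> x)"
    unfolding op using hi by (simp add: algebra_simps)
qed

lemma chain_op_in_span:
  assumes "orthonormal_upto (Suc m) u" "x \<in> span (u ` {..m})"
  shows "chain_op u x = (\<Sum>i\<le>m. ((chain_vec u i \<bullet> x) / wt i) *\<^sub>R chain_vec u i)"
  by (simp add: chain_op_def expansion_in_span[OF assms])

text \<open>The nonzero spectrum of a sum of rank-one operators is that of the Gram matrix, whose extreme
  eigenvectors are the constant and the alternating one.\<close>

lemma chain_op_eigenvector:
  assumes "orthonormal_upto (Suc m) u" "e = 1 \<or> e = -1"
  defines "v \<equiv> \<Sum>i\<le>m. e ^ i *\<^sub>R chain_vec u i"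
  shows "v \<noteq> 0" and "chain_op u v = (c * (cosh \<theta> - e)) *\<^sub>R v"
proof -
  have e2: "e * e = 1"
    using assms(2) by auto
  have "(\<Sum>i\<le>m. wt i * (e ^ i)\<^sup>2) > 0"
    using assms(2) by (intro sum_pos) (auto simp: wt_pos)
  then show "v \<noteq> 0"
    using norm_chain_sum_bounds(1)[OF assms(1), of "\<lambda>i. e ^ i"] \<nu>_pos
    by (auto simp: v_def mult_le_0_iff)
  have "v \<in> span (u ` {..m})"
    unfolding v_def using span_mono[of "u ` {.._}" "u ` {..m}"] chain_vec_span
    by (intro span_sum span_scale) auto
  then have "chain_op u v = (\<Sum>i\<le>m. ((chain_vec u i \<bullet> v) / wt i) *\<^sub>R chain_vec u i)"
    by (rule chain_op_in_span[OF assms(1)])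
  also have "\<dots> = (\<Sum>i\<le>m. (c * (cosh \<theta> - e) * e ^ i) *\<^sub>R chain_vec u i)"
  proof (intro sum.cong refl arg_cong2[of _ _ _ _ scaleR])
    fix i assume "i \<in> {..m}"
    then have i: "i \<le> m"
      by simp
    have prev: "e ^ (i - Suc 0) = e * e ^ i" if "0 < i"
      using that e2 by (cases i) (auto simp flip: mult.assoc)
    have "(if 0 < i then e ^ (i - 1) else 0) + (if i < m then e ^ Suc i else 0) = 2 * wt i * (e * e ^ i)"
      using i m_pos prev by (auto simp: wt_def)
    then show "(chain_vec u i \<bullet> v) / wt i = c * (cosh \<theta> - e) * e ^ i"
      unfolding v_def chain_vec_inner_sum[OF assms(1) i] using wt_pos[of i] by (simp add: field_simps)
  qed
  finally show "chain_op u v = (c * (cosh \<theta> - e)) *\<^sub>R v"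
    by (simp add: v_def scaleR_sum_right)
qed

text \<open>Tridiagonality: for x in the span of the first n vectors, every chain vector with index
  i > n is orthogonal to x, so the value at x reveals at most the one further vector
  \<open>u n\<close>.\<close>

lemma chain_op_cong:
  assumes "orthonormal_upto (Suc m) u" "orthonormal_upto (Suc m) u'" "n \<le> m" "\<forall>j\<le>n. u j = u' j"
    "x \<in> span (u ` {..<n})"
  shows "chain_op u x = chain_op u' x"
proof -
  have "u ` {..<n} = u' ` {..<n}"
    using assms(4) by (intro image_cong) auto
  then have x': "x \<in> span (u' ` {..<n})"
    using assms(5) by simp
  have zero: "u i \<bullet> x = 0" "u' i \<bullet> x = 0" if "n \<le> i" "i \<le> m" for i
    using that orthonormal_upto_inner_span[OF assms(1,5)] orthonormal_upto_inner_span[OF assms(2) x'] by auto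
  have "(u i \<bullet> x) *\<^sub>R u i = (u' i \<bullet> x) *\<^sub>R u' i" if "i \<le> m" for i
    using zero[of i] that assms(4) by (cases "i \<le> n") auto
  moreover have "((chain_vec u i \<bullet> x) / wt i) *\<^sub>R chain_vec u i
      = ((chain_vec u' i \<bullet> x) / wt i) *\<^sub>R chain_vec u' i" if "i \<le> m" for i
  proof (cases "i \<le> n")
    case True
    then have "chain_vec u i = chain_vec u' i"
      using assms(4) by (simp add: chain_vec_def)
    then show ?thesis
      by simp
  next
    case False
    then show ?thesis
      using that by (simp add: chain_vec_def inner_diff_left zero)
  qed
  ultimately show ?thesis
    by (simp add: chain_op_def)
qed

section \<open>The solution of the tridiagonal system and the distance to it\<close>

definition solution_coeff :: "real \<Rightarrow> nat \<Rightarrow> real" where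
  "solution_coeff r i = (if i < m then r * sqrt (tanh (real m * \<theta>) * sinh \<theta>
     / (cosh (real i * \<theta>) * cosh (real (Suc i) * \<theta>))) else r / cosh (real m * \<theta>))"

definition solution :: "real \<Rightarrow> (nat \<Rightarrow> 'a::real_inner) \<Rightarrow> 'a" where
  "solution r u = (\<Sum>i\<le>m. solution_coeff r i *\<^sub>R u i)"

text \<open>The factor 2 is \<open>1 / wt 0\<close>.\<close>

definition rhs_coeff :: "real \<Rightarrow> real" where
  "rhs_coeff r = 2 * (diagonal 0)\<^sup>2 * solution_coeff r 0"

lemma inner_solution:
  assumes "orthonormal_upto (Suc m) u" "i \<le> m"
  shows "u i \<bullet> solution r u = solution_coeff r i"
  using orthonormal_upto_inner_sum[OF assms(1), of i "solution_coeff r"] assms(2)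
  by (simp add: solution_def lessThan_Suc_atMost)

text \<open>The summands are the increments of tanh (i \<theta>). Up to the factor r^2 tanh (m
  \<theta>) they are the squares of all solution coefficients but the last, which is how the norm of
  the solution is computed.\<close>

lemma tanh_telescope:
  "(\<Sum>i<n. sinh \<theta> / (cosh (real i * \<theta>) * cosh (real (Suc i) * \<theta>))) = tanh (real n * \<theta>)"
proof (induction n)
  case (Suc n)
  have "tanh (real (Suc n) * \<theta>) - tanh (real n * \<theta>)
      = sinh (real (Suc n) * \<theta> - real n * \<theta>) / (cosh (real n * \<theta>) * cosh (real (Suc n) * \<theta>))"
    unfolding sinh_diff tanh_def by (simp add: field_simps del: of_nat_Suc)
  then show ?case
    using Suc.IH by (simp add: algebra_simps)
qed simp

lemma norm_solution:
  assumes "orthonormal_upto (Suc m) u" "0 \<le> r"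
  shows "norm (solution r u) = r"
proof -
  let ?T = "tanh (real m * \<theta>)"
  have "(norm (solution r u))\<^sup>2 = (\<Sum>i<m. (solution_coeff r i)\<^sup>2) + (solution_coeff r m)\<^sup>2"
    using norm_orthonormal_sum[OF assms(1), of "solution_coeff r"]
    by (simp add: solution_def lessThan_Suc_atMost[symmetric])
  also have "(\<Sum>i<m. (solution_coeff r i)\<^sup>2)
      = (\<Sum>i<m. r\<^sup>2 * ?T * (sinh \<theta> / (cosh (real i * \<theta>) * cosh (real (Suc i) * \<theta>))))"
    using \<theta>_pos by (intro sum.cong) (auto simp: solution_coeff_def power_mult_distrib)
  also have "\<dots> = r\<^sup>2 * ?T\<^sup>2"
    by (simp only: sum_distrib_left[symmetric] tanh_telescope) (simp add: power2_eq_square)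
  also have "\<dots> + (solution_coeff r m)\<^sup>2 = r\<^sup>2 * (?T\<^sup>2 + (1 / cosh (real m * \<theta>))\<^sup>2)"
    by (simp add: solution_coeff_def power_divide distrib_left)
  also have "?T\<^sup>2 + (1 / cosh (real m * \<theta>))\<^sup>2 = 1"
    by (simp add: tanh_def power_divide flip: add_divide_distrib cosh_square_eq)
  finally show ?thesis
    using assms(2) by simp
qed

text \<open>Makes the solution orthogonal to every chain vector except the first, so that its image
  under \<open>chain_op\<close> is a multiple of \<open>u 0\<close>.\<close>

lemma solution_coeff_step:
  assumes "0 < i" "i \<le> m"
  shows "diagonal i * solution_coeff r i = subdiagonal i * solution_coeff r (i - 1)"
proof -
  let ?C = "\<lambda>i. cosh (real i * \<theta>)"
  define K where "K = tanh (real m * \<theta>) * sinh \<theta>"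
  have pos: "0 < K" "\<And>i. 0 < ?C i"
    using \<theta>_pos m_pos by (simp_all add: K_def)
  have rhs: "subdiagonal i * solution_coeff r (i - 1) = r * sqrt (c / 2 * K / (?C i * ?C i))"
    using assms pos(2)[of "i - 1"] less_le_trans[of "i - Suc 0" i m]
    by (simp add: subdiagonal_def solution_coeff_def K_def mult.left_commute flip: real_sqrt_mult del: cosh_real_pos)
  have "diagonal i * solution_coeff r i = r * sqrt (c / 2 * K / (?C i * ?C i))"
  proof (cases "i = m")
    case True
    have "1 / ?C m = sqrt (1 / (?C m * ?C m))"
      by (simp add: real_sqrt_divide)
    then have "diagonal m * (1 / ?C m) = sqrt (c / 2 * K / (?C m * ?C m))"
      by (simp add: diagonal_def K_def tanh_def flip: real_sqrt_mult)
    then show ?thesis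
      by (simp add: True solution_coeff_def) (metis mult.commute times_divide_eq_right)
  next
    case False
    then show ?thesis
      using assms pos(2)[of "Suc i"]
      by (simp add: diagonal_def solution_coeff_def K_def mult.left_commute flip: real_sqrt_mult del: of_nat_Suc)
  qed
  then show ?thesis
    using rhs by simp
qed

lemma chain_op_solution:
  assumes "orthonormal_upto (Suc m) u"
  shows "chain_op u (solution r u) = rhs_coeff r *\<^sub>R u 0"
proof -
  have "solution r u \<in> span (u ` {..m})"
    unfolding solution_def by (intro span_sum span_scale span_base) auto
  then have "chain_op u (solution r u)
      = (\<Sum>i\<le>m. ((chain_vec u i \<bullet> solution r u) / wt i) *\<^sub>R chain_vec u i)"
    by (rule chain_op_in_span[OF assms])
  also have "\<dots> = (\<Sum>i\<le>m. if i = 0 then rhs_coeff r *\<^sub>R u 0 else 0)"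
  proof (intro sum.cong refl)
    fix i assume "i \<in> {..m}"
    then show "((chain_vec u i \<bullet> solution r u) / wt i) *\<^sub>R chain_vec u i
        = (if i = 0 then rhs_coeff r *\<^sub>R u 0 else 0)"
      using solution_coeff_step[of i r]
      by (auto simp: chain_vec_def inner_diff_left inner_solution[OF assms] wt_def rhs_coeff_def
          subdiagonal_def[of 0] power2_eq_square)
  qed
  finally show ?thesis
    by simp
qed

text \<open>x has no component along \<open>u m\<close>, so the last coordinate of the solution
  remains in the difference.\<close>

lemma dist_solution_ge:
  assumes "orthonormal_upto (Suc m) u" "x \<in> span (u ` {..<m})" "0 \<le> r"
  shows "norm (x - solution r u) \<ge> r / cosh (real m * \<theta>)"
proof -
  have "u m \<bullet> x = 0"
    by (rule orthonormal_upto_inner_span[OF assms(1,2)]) auto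
  then have "u m \<bullet> (x - solution r u) = - (r / cosh (real m * \<theta>))"
    by (simp add: inner_diff_right inner_solution[OF assms(1)] solution_coeff_def)
  moreover have "norm (u m) = 1"
    using orthonormal_uptoD[OF assms(1), of m m] by (simp add: norm_eq_sqrt_inner)
  ultimately show ?thesis
    using Cauchy_Schwarz_ineq2[of "u m" "x - solution r u"] assms(3) by simp
qed

end

section \<open>The hard instance\<close>

text \<open>Eigenvectors for distinct eigenvalues are orthogonal, hence independent. Finiteness
  gives \<open>Min\<close> and \<open>Max\<close> their meaning.\<close>

lemma finite_eigenvalues:
  fixes A :: "real^'n^'n"
  assumes "symmetric_mat A"
  shows "finite (eigenvalues A)"
proof -
  define g where "g c = (SOME v. v \<noteq> 0 \<and> A *v v = c *\<^sub>R v)" for c :: real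
  have g: "g c \<noteq> 0" "A *v g c = c *\<^sub>R g c" if "c \<in> eigenvalues A" for c
    using that someI_ex[of "\<lambda>v. v \<noteq> 0 \<and> A *v v = c *\<^sub>R v"] by (auto simp: g_def eigenvalues_def)
  have orth: "g c \<bullet> g d = 0" if "c \<in> eigenvalues A" "d \<in> eigenvalues A" "c \<noteq> d" for c d
    using symmetric_mat_inner[OF assms, of "g c" "g d"] g[OF that(1)] g[OF that(2)] that(3) by simp
  have "inj_on g (eigenvalues A)"
    using orth g(1) by (metis inj_onI inner_eq_zero_iff)
  moreover have "pairwise orthogonal (g ` eigenvalues A)"
    using orth by (auto simp: pairwise_def orthogonal_def)
  then have "finite (g ` eigenvalues A)"
    using g(1) by (intro finiteI_independent pairwise_orthogonal_independent) auto
  ultimately show ?thesis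
    using finite_imageD by blast
qed

lemma eigenvalue_in_range:
  fixes A :: "real^'n^'n"
  assumes "\<And>x. l * (x \<bullet> x) \<le> x \<bullet> (A *v x)" "\<And>x. x \<bullet> (A *v x) \<le> h * (x \<bullet> x)" "k \<in> eigenvalues A"
  shows "l \<le> k" "k \<le> h"
proof -
  obtain v where "v \<noteq> 0" "A *v v = k *\<^sub>R v"
    using assms(3) by (auto simp: eigenvalues_def)
  then show "l \<le> k" "k \<le> h"
    using assms(1)[of v] assms(2)[of v] by auto
qed

lemma lambda_min_max_eqI:
  fixes A :: "real^'n^'n"
  assumes "symmetric_mat A"
    and "\<And>x. l * (x \<bullet> x) \<le> x \<bullet> (A *v x)" "\<And>x. x \<bullet> (A *v x) \<le> h * (x \<bullet> x)"
    and "v \<noteq> 0" "A *v v = l *\<^sub>R v" "w \<noteq> 0" "A *v w = h *\<^sub>R w"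
  shows "lambda_min A = l" "lambda_max A = h"
proof -
  have "l \<in> eigenvalues A" "h \<in> eigenvalues A"
    using assms(4-7) by (auto simp: eigenvalues_def)
  then show "lambda_min A = l" "lambda_max A = h"
    unfolding lambda_min_def lambda_max_def
    using eigenvalue_in_range[OF assms(2,3)] finite_eigenvalues[OF assms(1)]
    by (auto intro: Min_eqI Max_eqI)
qed

lemma symmetric_matI:
  fixes A :: "real^'n^'n"
  assumes "\<And>x y. (A *v x) \<bullet> y = x \<bullet> (A *v y)"
  shows "symmetric_mat A"
proof -
  have "transpose A *v x = A *v x" for x
    by (rule vector_eq_rdot[THEN iffD1]) (simp add: assms dot_lmul_matrix)
  then show ?thesis
    by (simp add: symmetric_mat_def matrix_eq)
qed

lemma exp_rate_nonneg: "0 \<le> exp_rate a Q"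
  by (simp add: exp_rate_def)

lemma exp_rate_powr: "exp_rate a Q powr k = exp_rate (k * a) Q"
  by (simp add: exp_rate_def exp_powr_real mult.commute)

text \<open>Both lower bounds only use the distance to the stationary point \<open>z\<close>: the quadratic part
  contributes nonnegatively, and the power of the norm is uniformly convex of degree \<open>p\<close>.\<close>

lemma reg_quadratic_lower_bounds:
  fixes A :: "real^'n^'n"
  assumes "2 \<le> p" "psd_mat A" "0 < s" "gradient (reg_quadratic p s A b) z = 0"
    and "0 < r" "r * exp_rate a Q \<le> norm (x - z)"
  shows "is_arg_min (reg_quadratic p s A b) (\<lambda>_. True) y \<longleftrightarrow> y = z"
    and "reg_quadratic p s A b x - reg_quadratic p s A b z
      \<ge> s / (p * 2 powr (p - 2)) * r powr p * exp_rate (p * a) Q"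
    and "norm (gradient (reg_quadratic p s A b) x)
      \<ge> 2 powr (2 - p) * s / ((p - 1) powr ((p - 1) / p)) * r powr (p - 1) * exp_rate ((p - 1) * a) Q"
proof -
  let ?f = "reg_quadratic p s A b"
  have two: "2 powr (2 - p) = 1 / 2 powr (p - 2)"
    using powr_minus_divide[of 2 "p - 2"] by simp
  have pow: "r powr k * exp_rate (k * a) Q \<le> norm (x - z) powr k" if "0 \<le> k" for k
    using powr_mono2[OF that _ assms(6)] assms(5)
    by (simp add: powr_mult exp_rate_powr exp_rate_nonneg)
  have growth: "?f z < ?f y" if "y \<noteq> z" for y
  proof -
    have "0 < s / p * 2 powr (2 - p) * norm (y - z) powr p"
      using that assms(1,3) by simp
    then show ?thesis
      using reg_quadratic_growth[OF assms(1-4), of y] by linarith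
  qed
  then show "is_arg_min ?f (\<lambda>_. True) y \<longleftrightarrow> y = z"
    unfolding is_arg_min_def by (metis less_asym less_irrefl)
  have "s / (p * 2 powr (p - 2)) * (r powr p * exp_rate (p * a) Q)
      \<le> s / (p * 2 powr (p - 2)) * norm (x - z) powr p"
    using pow[of p] assms(1,3) by (intro mult_left_mono) auto
  also have "\<dots> \<le> ?f x - ?f z"
    using reg_quadratic_growth[OF assms(1-4), of x] by (simp add: two)
  finally show "?f x - ?f z \<ge> s / (p * 2 powr (p - 2)) * r powr p * exp_rate (p * a) Q"
    by (simp add: mult.assoc)
  \<comment> \<open>The claimed constant is therefore no larger than the one from uniform
    monotonicity.\<close>
  have "1 \<le> (p - 1) powr ((p - 1) / p)"
    using assms(1) by (intro ge_one_powr_ge_zero) auto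
  then have "2 powr (2 - p) * s / (p - 1) powr ((p - 1) / p) \<le> s * 2 powr (2 - p)"
    using assms(3) by (simp add: divide_le_eq mult_le_cancel_left1 mult.commute)
  then have "2 powr (2 - p) * s / (p - 1) powr ((p - 1) / p) * (r powr (p - 1) * exp_rate ((p - 1) * a) Q)
      \<le> s * 2 powr (2 - p) * norm (x - z) powr (p - 1)"
    using pow[of "p - 1"] assms(1,3) exp_rate_nonneg by (intro mult_mono) auto
  also have "\<dots> \<le> norm (gradient ?f x)"
    by (rule norm_gradient_reg_quadratic_ge[OF assms(1-4)])
  finally show "norm (gradient ?f x)
      \<ge> 2 powr (2 - p) * s / ((p - 1) powr ((p - 1) / p)) * r powr (p - 1) * exp_rate ((p - 1) * a) Q"
    by (simp add: mult.assoc)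
qed

text \<open>Value and gradient at x see the matrix only through its product with x.\<close>

lemma fo_info_reg_quadratic_cong:
  fixes A A' :: "real^'n^'n"
  assumes "2 \<le> p" "symmetric_mat A" "symmetric_mat A'" "A *v x = A' *v x"
  shows "fo_info (reg_quadratic p s A b) x = fo_info (reg_quadratic p s A' b) x"
  using assms by (simp add: fo_info_def gradient_reg_quadratic reg_quadratic_def)

text \<open>For \<mu> = L the rate is read as 0 and no distance bound is required, so a multiple of
  the identity serves every method.\<close>

lemma hard_instance_degenerate:
  fixes p s \<mu> r :: real
  assumes "2 \<le> p" "0 < s" "0 \<le> \<mu>" "0 < r"
  shows "\<exists>(A :: real^'d^'d) b z. psd_mat A \<and> lambda_min A = \<mu> \<and> lambda_max A = \<mu> \<and> norm z = r
    \<and> gradient (reg_quadratic p s A b) z = 0"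
proof -
  define A :: "real^'d^'d" where "A = matrix (\<lambda>x. \<mu> *\<^sub>R x)"
  have A: "A *v x = \<mu> *\<^sub>R x" for x
    unfolding A_def by (rule fun_cong[OF matrix_vector_mul(2)]) (intro linear_scaleR)
  define e :: "real^'d" where "e = axis undefined 1"
  have e: "norm e = 1"
    by (simp add: e_def)
  define b where "b = (\<mu> + s * r powr (p - 2)) *\<^sub>R (r *\<^sub>R e)"
  have sym: "symmetric_mat A"
    by (rule symmetric_matI) (simp add: A)
  have "psd_mat A"
    using sym assms(3) by (simp add: psd_mat_def A)
  moreover have "lambda_min A = \<mu>" "lambda_max A = \<mu>"
    using e by (intro lambda_min_max_eqI[OF sym, of \<mu> \<mu> e e]; auto simp: A)+
  moreover have "norm (r *\<^sub>R e) = r"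
    using e assms(4) by simp
  moreover have "gradient (reg_quadratic p s A b) (r *\<^sub>R e) = 0"
    using e assms(4) by (simp add: gradient_reg_quadratic[OF assms(1) sym] A b_def algebra_simps)
  ultimately show ?thesis
    by blast
qed

text \<open>Chooses \<theta> with cosh \<theta> = (Q + 1) / (Q - 1), so that a chain of half-width
  (h - l)/2 has extreme eigenvalues l and h. The last bound is ln (1 + t) \<le> t.\<close>

lemma condition_number_parametrization:
  fixes l h :: real
  assumes "0 < l" "l < h"
  defines "Q \<equiv> h / l"
  defines "\<theta> \<equiv> ln ((sqrt Q + 1) / (sqrt Q - 1))"
  shows "0 < \<theta>" "(h - l) / 2 * cosh \<theta> = (h + l) / 2" "\<theta> \<le> 2 / (sqrt Q - 1)"
proof -
  have "1 < Q"
    using assms(1,2) by (simp add: Q_def)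
  then have sq: "1 < sqrt Q" "sqrt Q * sqrt Q = Q"
    by auto
  then have gt: "1 < (sqrt Q + 1) / (sqrt Q - 1)"
    by simp
  then show "0 < \<theta>"
    by (simp add: \<theta>_def)
  have "cosh \<theta> = ((sqrt Q + 1) / (sqrt Q - 1) + (sqrt Q - 1) / (sqrt Q + 1)) / 2"
    unfolding \<theta>_def using gt by (subst cosh_ln_real) (simp_all add: inverse_eq_divide)
  also have "(sqrt Q + 1) / (sqrt Q - 1) + (sqrt Q - 1) / (sqrt Q + 1)
      = ((sqrt Q + 1) * (sqrt Q + 1) + (sqrt Q - 1) * (sqrt Q - 1)) / ((sqrt Q - 1) * (sqrt Q + 1))"
    by (subst add_frac_eq) (use sq(1) in linarith)+
  also have "(sqrt Q + 1) * (sqrt Q + 1) + (sqrt Q - 1) * (sqrt Q - 1) = 2 * (Q + 1)"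
    using sq(2) by (simp add: algebra_simps)
  also have "(sqrt Q - 1) * (sqrt Q + 1) = Q - 1"
    using sq(2) by (simp add: algebra_simps)
  also have "2 * (Q + 1) / (Q - 1) / 2 = (Q + 1) / (Q - 1)"
    using \<open>1 < Q\<close> by (simp add: field_simps)
  also have "\<dots> = (h + l) / (h - l)"
    using assms(1,2) by (simp add: Q_def field_simps)
  finally show "(h - l) / 2 * cosh \<theta> = (h + l) / 2"
    using assms(2) by (simp add: field_simps)
  have "(sqrt Q + 1) / (sqrt Q - 1) = 1 + 2 / (sqrt Q - 1)"
    using sq(1) by (simp add: field_simps)
  then show "\<theta> \<le> 2 / (sqrt Q - 1)"
    unfolding \<theta>_def using sq(1) ln_add_one_self_le_self[of "2 / (sqrt Q - 1)"] by simp
qed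

lemma hard_instance:
  fixes p s \<mu> L r :: real and M :: "(real^'d) first_order_method"
  assumes "2 \<le> p" "0 < s" "0 \<le> \<mu>" "\<mu> < L" "0 < r" "1 \<le> N" "2 * N < CARD('d)"
  defines "Q \<equiv> (L + s * r powr (p - 2)) / (\<mu> + s * r powr (p - 2))"
  shows "\<exists>(A :: real^'d^'d) b z. psd_mat A \<and> lambda_min A = \<mu> \<and> lambda_max A = L \<and> norm z = r
    \<and> gradient (reg_quadratic p s A b) z = 0
    \<and> norm (iterate M (reg_quadratic p s A b) N - z) \<ge> r * exp_rate (8 * real N) Q"
proof -
  define \<sigma> where "\<sigma> = s * r powr (p - 2)"
  have \<sigma>: "0 < \<sigma>"
    using assms(2,5) by (simp add: \<sigma>_def)
  have Q_eq: "Q = (L + \<sigma>) / (\<mu> + \<sigma>)"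
    by (simp add: Q_def \<sigma>_def)
  define \<theta> where "\<theta> = ln ((sqrt Q + 1) / (sqrt Q - 1))"
  have \<theta>: "0 < \<theta>" "(L - \<mu>) / 2 * cosh \<theta> = (L + \<mu>) / 2 + \<sigma>" "\<theta> \<le> 2 / (sqrt Q - 1)"
    using condition_number_parametrization[of "\<mu> + \<sigma>" "L + \<sigma>"] assms(3,4) \<sigma>
    by (simp_all add: \<theta>_def Q_eq add_divide_distrib)
  interpret chebyshev_chain "2 * N" "(L - \<mu>) / 2" \<theta>
    using assms(4,6) \<theta>(1) by unfold_locales auto
  have \<nu>: "\<nu> = \<mu> + \<sigma>" and \<Lambda>: "\<Lambda> = L + \<sigma>"
    using \<theta>(2) by (simp_all add: \<nu>_def \<Lambda>_def right_diff_distrib distrib_left field_simps)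
  \<comment> \<open>Shifting by \<sigma> anticipates the regularizer, whose gradient at a point z of
    norm r is \<sigma> z.\<close>
  define A :: "(nat \<Rightarrow> real^'d) \<Rightarrow> real^'d^'d" where "A u = matrix (\<lambda>x. chain_op u x - \<sigma> *\<^sub>R x)" for u
  define b :: "(nat \<Rightarrow> real^'d) \<Rightarrow> real^'d" where "b u = rhs_coeff r *\<^sub>R u 0" for u
  have A: "A u *v x = chain_op u x - \<sigma> *\<^sub>R x" for u x
    unfolding A_def by (rule fun_cong[OF matrix_vector_mul(2)]) (intro linear_compose_sub chain_op_linear linear_scaleR)
  have sym: "symmetric_mat (A u)" for u
    by (rule symmetric_matI) (simp add: A inner_diff_left inner_diff_right chain_op_self_adjoint)
  have "\<exists>u. orthonormal_upto (Suc (2 * N)) u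
      \<and> iterate M (reg_quadratic p s (A u) (b u)) N \<in> span (u ` {..<2 * N})"
  proof (rule resisting_oracle)
    show "2 * N < DIM(real^'d)"
      using assms(7) by simp
    fix u u' :: "nat \<Rightarrow> real^'d" and n x
    assume u: "orthonormal_upto (Suc (2 * N)) u" "orthonormal_upto (Suc (2 * N)) u'" "n \<le> 2 * N"
      "\<forall>j\<le>n. u j = u' j" "x \<in> span (u ` {..<n})"
    \<comment> \<open>Index 0 is always among those on which the two families agree, even for n =
      0.\<close>
    then have "b u = b u'"
      by (simp add: b_def)
    then show "fo_info (reg_quadratic p s (A u) (b u)) x = fo_info (reg_quadratic p s (A u') (b u')) x"
      using fo_info_reg_quadratic_cong[OF assms(1) sym sym, of u x u' s "b u"] chain_op_cong[OF u]
      by (simp add: A)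
  qed
  then obtain u where u: "orthonormal_upto (Suc (2 * N)) u"
    and x_N: "iterate M (reg_quadratic p s (A u) (b u)) N \<in> span (u ` {..<2 * N})"
    by blast
  have bounds: "\<mu> * (x \<bullet> x) \<le> x \<bullet> (A u *v x)" "x \<bullet> (A u *v x) \<le> L * (x \<bullet> x)" for x
    using chain_op_bounds[OF u, of x] by (simp_all add: A inner_diff_right \<nu> \<Lambda> algebra_simps)
  have "psd_mat (A u)"
    unfolding psd_mat_def
  proof (intro conjI allI)
    fix x
    show "0 \<le> x \<bullet> (A u *v x)"
      using bounds(1)[of x] assms(3) by (meson inner_ge_zero mult_nonneg_nonneg order_trans)
  qed (rule sym)
  moreover have "lambda_min (A u) = \<mu>" "lambda_max (A u) = L"
  proof -
    let ?v = "\<lambda>e::real. \<Sum>i\<le>2 * N. e ^ i *\<^sub>R chain_vec u i"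
    have eigen: "A u *v ?v e = ((L - \<mu>) / 2 * (cosh \<theta> - e) - \<sigma>) *\<^sub>R ?v e" if "e = 1 \<or> e = -1" for e
      by (simp only: A chain_op_eigenvector(2)[OF u that] scaleR_left_diff_distrib)
    \<comment> \<open>The constant sequence attains the lower end of the spectrum and the
      alternating one the upper end.\<close>
    have "(L - \<mu>) / 2 * (cosh \<theta> - 1) - \<sigma> = \<mu>" "(L - \<mu>) / 2 * (cosh \<theta> - - 1) - \<sigma> = L"
      using \<nu> \<Lambda> unfolding \<nu>_def \<Lambda>_def diff_minus_eq_add by linarith+
    then have "A u *v ?v 1 = \<mu> *\<^sub>R ?v 1" "A u *v ?v (-1) = L *\<^sub>R ?v (-1)"
      using eigen[of 1] eigen[of "-1"] by presburger+
    then show "lambda_min (A u) = \<mu>" "lambda_max (A u) = L"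
      using lambda_min_max_eqI[OF sym bounds] chain_op_eigenvector(1)[OF u, of 1]
        chain_op_eigenvector(1)[OF u, of "-1"] by blast+
  qed
  moreover have norm_z: "norm (solution r u) = r"
    using norm_solution[OF u] assms(5) by simp
  moreover have "gradient (reg_quadratic p s (A u) (b u)) (solution r u) = 0"
    by (simp add: gradient_reg_quadratic[OF assms(1) sym] A b_def chain_op_solution[OF u] norm_z \<sigma>_def)
  moreover have "r * exp_rate (8 * real N) Q \<le> norm (iterate M (reg_quadratic p s (A u) (b u)) N - solution r u)"
  proof -
    have "1 < Q"
      using assms(3,4) \<sigma> by (simp add: Q_eq)
    then have sq: "1 < sqrt Q"
      by simp
    have "cosh (real (2 * N) * \<theta>) \<le> exp (real (2 * N) * \<theta>)"
      using \<theta>(1) by (simp add: cosh_field_def)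
    also have "\<dots> \<le> exp (8 * real N / (sqrt Q - 1))"
    proof -
      \<comment> \<open>The exponent obtained is 4 N / (sqrt Q - 1), half of what the claim
        allows.\<close>
      have "real (2 * N) * \<theta> \<le> real (2 * N) * (2 / (sqrt Q - 1))"
        by (intro mult_left_mono \<theta>(3)) simp
      also have "\<dots> \<le> 8 * real N / (sqrt Q - 1)"
        using sq by (simp add: divide_right_mono)
      finally show ?thesis
        by simp
    qed
    finally have "r / exp (8 * real N / (sqrt Q - 1)) \<le> r / cosh (real (2 * N) * \<theta>)"
      using assms(5) by (intro divide_left_mono) auto
    also have "\<dots> \<le> norm (iterate M (reg_quadratic p s (A u) (b u)) N - solution r u)"
      using dist_solution_ge[OF u x_N] assms(5) by simp
    finally show ?thesis
      using \<open>1 < Q\<close> by (simp add: exp_rate_def exp_minus divide_inverse)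
  qed
  ultimately show ?thesis
    by blast
qed

theorem theorem20:
  fixes p s \<mu> L r Q :: real
    and N :: nat
    and M :: "(real ^ 'd) first_order_method"
  assumes "p \<ge> 2" and "s > 0" and "0 \<le> \<mu>" and "\<mu> \<le> L" and "r > 0"
    and "N \<ge> 1" and "real N \<le> (real CARD('d) - 1) / 2"
    and "Q = (L + s * r powr (p - 2)) / (\<mu> + s * r powr (p - 2))"
  shows "Q \<ge> 1 \<and>
    (\<exists>(A :: real ^ 'd ^ 'd) (b :: real ^ 'd) (x_star :: real ^ 'd).
      let f = reg_quadratic p s A b; x_N = iterate M f N in
        psd_mat A \<and>
        (\<forall>y. is_arg_min f (\<lambda>_. True) y \<longleftrightarrow> y = x_star) \<and>
        norm x_star = r \<and>
        lambda_min A = \<mu> \<and>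
        lambda_max A = L \<and>
        norm (x_N - x_star) \<ge> r * exp_rate (8 * real N) Q \<and>
        f x_N - f x_star \<ge>
          s / (p * 2 powr (p - 2)) * r powr p * exp_rate (8 * p * real N) Q \<and>
        norm (gradient f x_N) \<ge>
          2 powr (2 - p) * s / ((p - 1) powr ((p - 1) / p)) * r powr (p - 1)
            * exp_rate (8 * (p - 1) * real N) Q)"
proof
  have pos: "0 < \<mu> + s * r powr (p - 2)"
    using assms(2,3,5) by (simp add: add_nonneg_pos)
  then show "1 \<le> Q"
    using assms(4,8) by simp
  obtain A :: "real ^ 'd ^ 'd" and b z where A: "psd_mat A" "lambda_min A = \<mu>" "lambda_max A = L"
    "norm z = r" "gradient (reg_quadratic p s A b) z = 0"
    "r * exp_rate (8 * real N) Q \<le> norm (iterate M (reg_quadratic p s A b) N - z)"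
  proof (cases "\<mu> = L")
    case True
    then have "Q = 1"
      using pos assms(8) by simp
    then show ?thesis
      using hard_instance_degenerate[OF assms(1,2,3,5), where 'd = 'd] that True
      by (auto simp: exp_rate_def)
  next
    case False
    \<comment> \<open>The hypothesis on N leaves room for the 2 N + 1 orthonormal vectors.\<close>
    moreover have "2 * N < CARD('d)"
      using assms(7) by (simp add: field_simps flip: of_nat_less_iff[where 'a = real])
    ultimately show ?thesis
      using hard_instance[of p s \<mu> L r N M] assms that by auto
  qed
  have rate: "8 * k * real N = k * (8 * real N)" for k :: real
    by simp
  show "\<exists>(A :: real ^ 'd ^ 'd) (b :: real ^ 'd) (x_star :: real ^ 'd).
      let f = reg_quadratic p s A b; x_N = iterate M f N in
        psd_mat A \<and>
        (\<forall>y. is_arg_min f (\<lambda>_. True) y \<longleftrightarrow> y = x_star) \<and>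
        norm x_star = r \<and>
        lambda_min A = \<mu> \<and>
        lambda_max A = L \<and>
        norm (x_N - x_star) \<ge> r * exp_rate (8 * real N) Q \<and>
        f x_N - f x_star \<ge>
          s / (p * 2 powr (p - 2)) * r powr p * exp_rate (8 * p * real N) Q \<and>
        norm (gradient f x_N) \<ge>
          2 powr (2 - p) * s / ((p - 1) powr ((p - 1) / p)) * r powr (p - 1)
            * exp_rate (8 * (p - 1) * real N) Q"
    unfolding Let_def rate
    using A reg_quadratic_lower_bounds[OF assms(1) A(1) assms(2) A(5) assms(5) A(6)] by blast
qed

end
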